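(* Let $p\colon E\to B$ be a fibration and let $R$ be a commutative ring. Suppose there exist cohomology classes $u_0,u_1,\dots,u_k\in H^*(B;R)$ with $$p^*(u_0)=p^*(u_1)=\cdots=p^*(u_k)=0\quad\text{and}\quad u_0\smile u_1\smile\cdots\smile u_k\ne 0 .$$ Then $\mathrm{secat}_m(p)\ge k+1$, where $m=\max\{\deg(u_i)\mid i=0,1,\dots,k\}$.
   Context: Cohomology classes are homogeneous, and $\deg(u)$ is the degree of $u$. A fibration is a map with the homotopy lifting property. For a fibration $p\colon E\to B$ and an integer $m\ge 0$, the $m$-sectional category $\mathrm{secat}_m(p)$ is the least integer $k$ such that $B$ admits an open cover $\{U_i\}_{i=0}^k$ with the property: for each $i$, every $m$-dimensional CW complex $P$ and every map $\phi\colon P\to U_i$, there is a map $s\colon P\to E$ with $p\circ s=\iota_{U_i}\circ\phi$, where $\iota_{U_i}\colon U_i\hookrightarrow B$ is the inclusion. If no such cover exists, $\mathrm{secat}_m(p)=\infty$. *)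

theory Defs
  imports "HOL-Analysis.Analysis" "HOL-Homology.Homology" "HOL-Library.Extended_Nat"
begin

section \<open>Fibrations\<close>

definition homotopy_lifting ::
  "'x topology \<Rightarrow> 'e topology \<Rightarrow> 'b topology \<Rightarrow> ('e \<Rightarrow> 'b) \<Rightarrow> bool" where
  "homotopy_lifting X E B p \<longleftrightarrow>
     (\<forall>f h. continuous_map X E f \<and>
            continuous_map (prod_topology (top_of_set {0..1::real}) X) B h \<and>
            (\<forall>x\<in>topspace X. h (0, x) = p (f x)) \<longrightarrow>
        (\<exists>g. continuous_map (prod_topology (top_of_set {0..1::real}) X) E g \<and>
             (\<forall>x\<in>topspace X. g (0, x) = f x) \<and>
             (\<forall>t\<in>{0..1}. \<forall>x\<in>topspace X. p (g (t, x)) = h (t, x))))"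

text \<open>
  A definition cannot quantify over types, so the test spaces live on the fixed type
  \<^typ>\<open>'e \<times> (real \<Rightarrow> 'b)\<close>, which is large enough to carry the mapping path space of \<open>p\<close>.
  The lemma \<open>fibration_imp_homotopy_lifting\<close> below shows that nothing is lost: the lifting
  property then holds for all spaces on all types.
\<close>

definition fibration :: "'e topology \<Rightarrow> 'b topology \<Rightarrow> ('e \<Rightarrow> 'b) \<Rightarrow> bool" where
  "fibration E B p \<longleftrightarrow>
     continuous_map E B p \<and>
     (\<forall>X :: ('e \<times> (real \<Rightarrow> 'b)) topology. homotopy_lifting X E B p)"

lemma ex_quotient_on_image:
  obtains Y where "quotient_map X Y j"
proof -
  define Q where "Q = (\<lambda>S. S \<subseteq> j ` topspace X \<and> openin X {x \<in> topspace X. j x \<in> S})"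
  have top: "istopology Q"
    unfolding istopology_def
  proof (intro conjI allI impI)
    fix S T assume "Q S" "Q T"
    moreover have "{x \<in> topspace X. j x \<in> S \<inter> T}
                 = {x \<in> topspace X. j x \<in> S} \<inter> {x \<in> topspace X. j x \<in> T}"
      by auto
    ultimately show "Q (S \<inter> T)"
      by (auto simp: Q_def)
  next
    fix \<K> assume "\<forall>K\<in>\<K>. Q K"
    moreover have "{x \<in> topspace X. j x \<in> \<Union>\<K>} = (\<Union>K\<in>\<K>. {x \<in> topspace X. j x \<in> K})"
      by auto
    ultimately show "Q (\<Union>\<K>)"
      by (auto simp: Q_def)
  qed
  have open_iff: "openin (topology Q) = Q"
    by (rule topology_inverse'[OF top])
  have "{x \<in> topspace X. j x \<in> j ` topspace X} = topspace X"
    by auto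
  then have "Q (j ` topspace X)"
    by (simp add: Q_def)
  moreover have "S \<subseteq> j ` topspace X" if "Q S" for S
    using that by (simp add: Q_def)
  ultimately have "topspace (topology Q) = j ` topspace X"
    unfolding topspace_def[of "topology Q"] open_iff by blast
  moreover have "openin X {x \<in> topspace X. j x \<in> S} \<longleftrightarrow> openin (topology Q) S"
    if "S \<subseteq> j ` topspace X" for S
    using that by (simp add: open_iff) (simp add: Q_def)
  ultimately have "quotient_map X (topology Q) j"
    by (simp add: quotient_map_def)
  then show thesis
    by (rule that)
qed

lemma fibration_imp_homotopy_lifting:
  fixes X :: "'x topology" and E :: "'e topology" and B :: "'b topology"
  assumes "fibration E B p"
  shows "homotopy_lifting X E B p"
  unfolding homotopy_lifting_def
proof (intro allI impI, elim conjE)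
  let ?I = "top_of_set {0..1::real}"
  fix f :: "'x \<Rightarrow> 'e" and h :: "real \<times> 'x \<Rightarrow> 'b"
  assume f: "continuous_map X E f" and h: "continuous_map (prod_topology ?I X) B h"
    and h0: "\<forall>x\<in>topspace X. h (0, x) = p (f x)"
  define j where "j = (\<lambda>x. (f x, \<lambda>t. h (t, x)))"
  obtain Y where Y: "quotient_map X Y j"
    by (rule ex_quotient_on_image)
  have lc: "locally_compact_space ?I"
    by (simp add: compact_imp_locally_compact_space compact_space_subtopology)
  have haus: "Hausdorff_space ?I"
    by (simp add: Hausdorff_space_subtopology)
  have q: "quotient_map (prod_topology ?I X) (prod_topology ?I Y) (\<lambda>(t,x). (t, j x))"
    using quotient_map_prod_right[OF lc _ Y] haus by blast
  have img: "j ` topspace X = topspace Y"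
    using Y by (simp add: quotient_map_def)
  have "continuous_map Y E fst"
    by (rule continuous_compose_quotient_map[OF Y]) (simp add: j_def comp_def f)
  moreover have "continuous_map (prod_topology ?I Y) B (\<lambda>(t,y). snd y t)"
    by (rule continuous_compose_quotient_map[OF q])
       (use h in \<open>simp add: j_def comp_def case_prod_unfold\<close>)
  moreover have "\<forall>y\<in>topspace Y. (\<lambda>(t,y). snd y t) (0, y) = p (fst y)"
    using h0 by (auto simp flip: img simp: j_def)
  moreover have "homotopy_lifting Y E B p"
    using assms by (simp add: fibration_def)
  ultimately obtain g where g: "continuous_map (prod_topology ?I Y) E g"
    and g0: "\<forall>y\<in>topspace Y. g (0, y) = fst y"
    and pg: "\<forall>t\<in>{0..1}. \<forall>y\<in>topspace Y. p (g (t, y)) = (\<lambda>(t,y). snd y t) (t, y)"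
    unfolding homotopy_lifting_def by blast
  let ?g = "g \<circ> (\<lambda>(t,x). (t, j x))"
  have "continuous_map (prod_topology ?I X) E ?g"
    using continuous_map_compose[OF quotient_imp_continuous_map[OF q] g] .
  moreover have "\<forall>x\<in>topspace X. ?g (0, x) = f x"
    using g0 by (auto simp flip: img simp: j_def)
  moreover have "\<forall>t\<in>{0..1}. \<forall>x\<in>topspace X. p (?g (t, x)) = h (t, x)"
    using pg by (auto simp flip: img simp: j_def)
  ultimately show "\<exists>g. continuous_map (prod_topology ?I X) E g \<and>
             (\<forall>x\<in>topspace X. g (0, x) = f x) \<and>
             (\<forall>t\<in>{0..1}. \<forall>x\<in>topspace X. p (g (t, x)) = h (t, x))"
    by blast
qed


section \<open>CW complexes\<close>

text \<open>As for \<^const>\<open>nsphere\<close>, points of the \<open>n\<close>-disc are sequences vanishing from index \<open>n\<close> on.\<close>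

definition disc :: "nat \<Rightarrow> (nat \<Rightarrow> real) topology" where
  "disc n = subtopology (Euclidean_space n) {x. (\<Sum>i<n. (x i)\<^sup>2) \<le> 1}"

definition disc_interior :: "nat \<Rightarrow> (nat \<Rightarrow> real) set" where
  "disc_interior n = {x \<in> topspace (disc n). (\<Sum>i<n. (x i)\<^sup>2) < 1}"

definition disc_boundary :: "nat \<Rightarrow> (nat \<Rightarrow> real) set" where
  "disc_boundary n = {x \<in> topspace (disc n). (\<Sum>i<n. (x i)\<^sup>2) = 1}"

text \<open>
  Whitehead's definition. A cell is given as a pair of its dimension \<open>n\<close> and its characteristic
  map \<open>\<Phi>\<close> on the \<open>n\<close>-disc. The conditions are: the open cells partition the space, the boundary
  of each cell meets only finitely many open cells, all of lower dimension, and the space carries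
  the weak topology.
\<close>

definition CW_structure :: "'a topology \<Rightarrow> (nat \<times> ((nat \<Rightarrow> real) \<Rightarrow> 'a)) set \<Rightarrow> bool" where
  "CW_structure P C \<longleftrightarrow>
     Hausdorff_space P \<and>
     (\<forall>(n, \<Phi>)\<in>C. continuous_map (disc n) P \<Phi> \<and>
                 embedding_map (subtopology (disc n) (disc_interior n)) P \<Phi>) \<and>
     disjoint_family_on (\<lambda>(n, \<Phi>). \<Phi> ` disc_interior n) C \<and>
     (\<Union>(n, \<Phi>)\<in>C. \<Phi> ` disc_interior n) = topspace P \<and>
     (\<forall>(n, \<Phi>)\<in>C. \<exists>F\<subseteq>C. finite F \<and> (\<forall>(l, \<Psi>)\<in>F. l < n) \<and>
                 \<Phi> ` disc_boundary n \<subseteq> (\<Union>(l, \<Psi>)\<in>F. \<Psi> ` disc_interior l)) \<and>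
     (\<forall>A\<subseteq>topspace P. closedin P A \<longleftrightarrow>
        (\<forall>(n, \<Phi>)\<in>C. closedin (disc n) {x \<in> topspace (disc n). \<Phi> x \<in> A}))"

definition CW_complex_of_dim :: "nat \<Rightarrow> 'a topology \<Rightarrow> bool" where
  "CW_complex_of_dim m P \<longleftrightarrow>
     (\<exists>C. CW_structure P C \<and> (\<forall>(n, \<Phi>)\<in>C. n \<le> m) \<and> (\<exists>\<Phi>. (m, \<Phi>) \<in> C))"


section \<open>The \<open>m\<close>-sectional category\<close>

text \<open>
  Again the test complexes have to live on a fixed type, depending on the type \<open>'b\<close> of points of
  the base. A type carrying all pairs of a singular simplex of the base and a point of
  \<open>\<real>\<^sup>\<infinity>\<close> suffices for the lifting condition to hold for the \<open>m\<close>-dimensional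
  complexes \<open>P\<close> of every type: given \<open>\<phi> : P \<rightarrow> U\<close>, identify, by induction over the skeleta,
  those cells of \<open>P\<close> whose attaching maps into the part already constructed agree and whose
  characteristic maps agree after composition with \<open>\<phi>\<close>. The result is an \<open>m\<close>-dimensional
  complex \<open>Q\<close> together with a factorization \<open>P \<rightarrow> Q \<rightarrow> U\<close> of \<open>\<phi>\<close>, and its cardinality is
  at most that of \<open>'b cw_point\<close>, because a map from a sphere to a complex meets only finitely
  many cells.
\<close>

type_synonym 'b cw_point = "((nat \<Rightarrow> real) \<Rightarrow> 'b) \<times> (nat \<Rightarrow> real)"

definition CW_liftable ::
  "nat \<Rightarrow> 'e topology \<Rightarrow> 'b topology \<Rightarrow> ('e \<Rightarrow> 'b) \<Rightarrow> 'b set \<Rightarrow> bool" where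
  "CW_liftable m E B p U \<longleftrightarrow>
     (\<forall>(P :: 'b cw_point topology) \<phi>.
        CW_complex_of_dim m P \<and> continuous_map P (subtopology B U) \<phi> \<longrightarrow>
        (\<exists>s. continuous_map P E s \<and> (\<forall>x\<in>topspace P. p (s x) = \<phi> x)))"

text \<open>The infimum of the empty set in \<^typ>\<open>enat\<close> is \<open>\<infinity>\<close>.\<close>

definition secat :: "nat \<Rightarrow> 'e topology \<Rightarrow> 'b topology \<Rightarrow> ('e \<Rightarrow> 'b) \<Rightarrow> enat" where
  "secat m E B p =
     Inf {enat k | k. \<exists>U :: nat \<Rightarrow> 'b set.
            (\<forall>i\<le>k. openin B (U i)) \<and> (\<Union>i\<le>k. U i) = topspace B \<and>
            (\<forall>i\<le>k. CW_liftable m E B p (U i))}"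


section \<open>Singular cohomology\<close>

text \<open>
  An \<open>n\<close>-cochain, i.e. a homomorphism from the free abelian group on the singular
  \<open>n\<close>-simplices to \<open>'r\<close>, is represented by its values on the simplices; it is \<open>0\<close> on functions
  that are not singular \<open>n\<close>-simplices. The ring need not have a unit, hence the signs are
  written as case distinctions. Groups are written additively in the mathematics but are
  records of type \<^typ>\<open>'c monoid\<close> here, as for the homology groups of the library; in
  particular \<open>\<one>\<close> of a cohomology group is its zero class.
\<close>

type_synonym ('a, 'r) cochain = "((nat \<Rightarrow> real) \<Rightarrow> 'a) \<Rightarrow> 'r"

definition singular_cochain :: "nat \<Rightarrow> 'a topology \<Rightarrow> ('a, 'r::comm_ring) cochain \<Rightarrow> bool" where
  "singular_cochain n X c \<longleftrightarrow> (\<forall>\<sigma>. \<not> singular_simplex n X \<sigma> \<longrightarrow> c \<sigma> = 0)"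

definition coboundary ::
  "nat \<Rightarrow> 'a topology \<Rightarrow> ('a, 'r::comm_ring) cochain \<Rightarrow> ('a, 'r) cochain" where
  "coboundary n X c =
     (\<lambda>\<sigma>. if singular_simplex (Suc n) X \<sigma>
          then \<Sum>k\<le>Suc n. if even k then c (singular_face (Suc n) k \<sigma>)
                               else - c (singular_face (Suc n) k \<sigma>)
          else 0)"

definition cocycle_group ::
  "nat \<Rightarrow> 'a topology \<Rightarrow> ('a, 'r::comm_ring) cochain monoid" where
  "cocycle_group n X =
     \<lparr>carrier = {c. singular_cochain n X c \<and> coboundary n X c = (\<lambda>\<sigma>. 0)},
      monoid.mult = (\<lambda>a b \<sigma>. a \<sigma> + b \<sigma>), one = (\<lambda>\<sigma>. 0)\<rparr>"

definition coboundaries :: "nat \<Rightarrow> 'a topology \<Rightarrow> ('a, 'r::comm_ring) cochain set" where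
  "coboundaries n X =
     (case n of 0 \<Rightarrow> {\<lambda>\<sigma>. 0} | Suc l \<Rightarrow> coboundary l X ` {c. singular_cochain l X c})"

definition cohomology_group ::
  "nat \<Rightarrow> 'a topology \<Rightarrow> ('a, 'r::comm_ring) cochain set monoid" where
  "cohomology_group n X = cocycle_group n X Mod coboundaries n X"

definition cohomology_class ::
  "nat \<Rightarrow> 'a topology \<Rightarrow> ('a, 'r::comm_ring) cochain \<Rightarrow> ('a, 'r) cochain set" where
  "cohomology_class n X c = coboundaries n X #>\<^bsub>cocycle_group n X\<^esub> c"

definition cochain_pullback ::
  "nat \<Rightarrow> 'a topology \<Rightarrow> ('a \<Rightarrow> 'b) \<Rightarrow> ('b, 'r::comm_ring) cochain \<Rightarrow> ('a, 'r) cochain" where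
  "cochain_pullback n X f c =
     (\<lambda>\<sigma>. if singular_simplex n X \<sigma> then c (simplex_map n f \<sigma>) else 0)"

text \<open>
  The operations on classes are induced by those on representatives: the unions below are
  over equal cosets.
\<close>

definition cohomology_pullback ::
  "nat \<Rightarrow> 'a topology \<Rightarrow> ('a \<Rightarrow> 'b) \<Rightarrow> ('b, 'r::comm_ring) cochain set \<Rightarrow> ('a, 'r) cochain set"
  where
  "cohomology_pullback n X f u = (\<Union>c\<in>u. cohomology_class n X (cochain_pullback n X f c))"

definition front_face :: "nat \<Rightarrow> ((nat \<Rightarrow> real) \<Rightarrow> 'a) \<Rightarrow> (nat \<Rightarrow> real) \<Rightarrow> 'a" where
  "front_face a \<sigma> = restrict \<sigma> (standard_simplex a)"

definition back_face :: "nat \<Rightarrow> nat \<Rightarrow> ((nat \<Rightarrow> real) \<Rightarrow> 'a) \<Rightarrow> (nat \<Rightarrow> real) \<Rightarrow> 'a" where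
  "back_face a b \<sigma> = restrict (\<lambda>x. \<sigma> (\<lambda>i. if i < a then 0 else x (i - a))) (standard_simplex b)"

definition cochain_cup ::
  "'a topology \<Rightarrow> nat \<Rightarrow> nat \<Rightarrow> ('a, 'r::comm_ring) cochain \<Rightarrow> ('a, 'r) cochain
     \<Rightarrow> ('a, 'r) cochain" where
  "cochain_cup X a b c d =
     (\<lambda>\<sigma>. if singular_simplex (a + b) X \<sigma> then c (front_face a \<sigma>) * d (back_face a b \<sigma>) else 0)"

definition cup ::
  "'a topology \<Rightarrow> nat \<Rightarrow> nat \<Rightarrow> ('a, 'r::comm_ring) cochain set \<Rightarrow> ('a, 'r) cochain set
     \<Rightarrow> ('a, 'r) cochain set" where
  "cup X a b u v = (\<Union>c\<in>u. \<Union>d\<in>v. cohomology_class (a + b) X (cochain_cup X a b c d))"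

text \<open>The product of the classes \<open>u 0, \<dots>, u k\<close>, where \<open>u i\<close> has degree \<open>d i\<close>.\<close>

primrec cup_upto ::
  "'a topology \<Rightarrow> (nat \<Rightarrow> nat) \<Rightarrow> (nat \<Rightarrow> ('a, 'r::comm_ring) cochain set) \<Rightarrow> nat
     \<Rightarrow> ('a, 'r) cochain set" where
  "cup_upto X d u 0 = u 0"
| "cup_upto X d u (Suc k) = cup X (\<Sum>i\<le>k. d i) (d (Suc k)) (cup_upto X d u k) (u (Suc k))"

end

theory Submission
  imports Defs
begin

text \<open>
  Suppose that \<open>B\<close> is covered by at most \<open>k + 1\<close> open sets over which maps from \<open>m\<close>-dimensional
  complexes lift to \<open>E\<close>. Two things are shown: a class \<open>u\<close> of degree at most \<open>m\<close> with
  \<open>p\<^sup>* u = 0\<close> vanishes on each such set \<open>U\<close>; and a product of classes, the \<open>i\<close>-th of which vanishes on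
  the \<open>i\<close>-th set of an open cover, is zero. Together they contradict the nonvanishing of the product
  \<open>u\<^sub>0 \<smile> \<dots> \<smile> u\<^sub>k\<close>.

  For the first claim one would pass to a CW approximation of \<open>U\<close>, and to its \<open>m\<close>-skeleton, on which
  cohomology in degrees up to \<open>m\<close> is still detected. A specific model makes this explicit: the
  realization of the singular complex of \<open>U\<close> that glues the standard simplices along their faces and
  collapses no degenerate ones. Its \<open>m\<close>-skeleton has one cell for each singular simplex of \<open>U\<close>
  of dimension at most \<open>m\<close>, and evaluation is a map from it to \<open>U\<close>. A lift of the evaluation to \<open>E\<close>
  assigns to each singular simplex \<open>\<sigma>\<close> of \<open>U\<close> a singular simplex of \<open>E\<close> over \<open>\<sigma>\<close>, compatibly with
  faces: it is a section of the chain map induced by \<open>p\<close> in dimensions up to \<open>m\<close>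
  (\<open>CW_liftable_imp_simplex_lifts\<close>). Pulling back along this section a cochain on \<open>E\<close> that bounds
  \<open>p\<^sup>* u\<close> gives a cochain that bounds \<open>u\<close> on \<open>U\<close> (\<open>coboundary_on_liftable\<close>). It remains to see that
  the model is a CW complex (\<open>CW_structure_skeleton\<close>); the Hausdorff property is the point there
  (\<open>Hausdorff_space_skeleton\<close>).

  For the second claim, representatives are changed by coboundaries so that the \<open>i\<close>-th one vanishes on
  the singular simplices of the \<open>i\<close>-th set. Their product then vanishes on all simplices that
  lie in a single member of the cover, since the front and back faces of such a simplex lie there too.
  Iterated barycentric subdivision shows that a cocycle with this property is a coboundary
  (\<open>cocycle_vanishing_on_small_simplices\<close>); this replaces the relative cup product
  and excision.
\<close>

section \<open>Evaluating cochains on chains\<close>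

text \<open>
  The subdivision operator and its homotopy to the identity are operations on chains. Cochains, which are
  mere functions on simplices, meet them through their additive extensions to chains.
\<close>

definition extends_cochain :: "('a, 'r::comm_ring) cochain \<Rightarrow> ('a chain \<Rightarrow> 'r) \<Rightarrow> bool" where
  "extends_cochain c e \<longleftrightarrow> Modules.additive e \<and> (\<forall>\<sigma>. e (frag_of \<sigma>) = c \<sigma>)"

text \<open>
  The ring may lack a unit, so integers cannot be mapped into it. The universal property of
  the free abelian group on the singular simplices, applied to the additive group of the ring, avoids
  integer multiples of ring elements.
\<close>

lemma ex_extends_cochain:
  fixes c :: "('a, 'r::comm_ring) cochain"
  obtains e where "extends_cochain c e"
proof -
  let ?G = "\<lparr>carrier = UNIV, monoid.mult = (+), one = 0\<rparr> :: 'r monoid"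
  have "comm_group ?G"
    by (rule comm_groupI) (auto simp: add_ac intro: exI[of _ "- _"])
  then obtain e where e: "e \<in> hom (free_Abelian_group UNIV) ?G" "\<And>\<sigma>. e (frag_of \<sigma>) = c \<sigma>"
    using comm_group.free_Abelian_group_universal[of ?G c UNIV] by auto
  have "e (x + y) = e x + e y" for x y
    using hom_mult[OF e(1), of x y] by simp
  with e(2) have "extends_cochain c e" by (simp add: extends_cochain_def Modules.additive_def)
  then show thesis by (rule that)
qed

lemma additive_frag_cmul_sign:
  assumes "Modules.additive (e :: 'a chain \<Rightarrow> 'r::comm_ring)"
  shows "e (frag_cmul ((-1) ^ k) z) = (if even k then e z else - e z)"
  by (cases "even k") (simp_all add: Modules.additive.minus[OF assms])

lemma additive_chain_boundary_of:
  assumes "Modules.additive (e :: 'a chain \<Rightarrow> 'r::comm_ring)"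
  shows "e (chain_boundary (Suc n) (frag_of \<sigma>)) =
    (\<Sum>k\<le>Suc n. if even k then e (frag_of (singular_face (Suc n) k \<sigma>))
                 else - e (frag_of (singular_face (Suc n) k \<sigma>)))"
  unfolding chain_boundary_of
  by (simp add: Modules.additive.sum[OF assms] additive_frag_cmul_sign[OF assms] del: sum.atMost_Suc)

lemma coboundary_eq_extension:
  assumes "extends_cochain c e" "singular_simplex (Suc n) X \<sigma>"
  shows "coboundary n X c \<sigma> = e (chain_boundary (Suc n) (frag_of \<sigma>))"
  using assms additive_chain_boundary_of[of e n \<sigma>]
  by (simp add: extends_cochain_def coboundary_def del: sum.atMost_Suc cong: if_cong)

lemma additive_eq_0:
  assumes "Modules.additive e" "\<And>\<sigma>. \<sigma> \<in> Poly_Mapping.keys z \<Longrightarrow> e (frag_of \<sigma>) = 0"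
  shows "e z = 0"
proof -
  have "Poly_Mapping.keys z \<subseteq> {\<sigma>. e (frag_of \<sigma>) = 0}" using assms(2) by blast
  then show ?thesis
    by (induction rule: frag_induction)
       (simp_all add: Modules.additive.zero[OF assms(1)] Modules.additive.diff[OF assms(1)])
qed

text \<open>
  This is dual to \<open>\<partial> \<circ> \<partial> = 0\<close>, hence follows from it by additive extension.
\<close>

lemma coboundary_coboundary:
  "coboundary (Suc n) X (coboundary n X c) = (\<lambda>\<sigma>. 0)"
proof
  fix \<sigma>
  show "coboundary (Suc n) X (coboundary n X c) \<sigma> = 0"
  proof (cases "singular_simplex (Suc (Suc n)) X \<sigma>")
    case True
    obtain e where e: "extends_cochain c e" using ex_extends_cochain .
    then have add: "Modules.additive e" by (simp add: extends_cochain_def)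
    have add': "Modules.additive (\<lambda>z. e (chain_boundary (Suc n) z))"
      by (simp add: Modules.additive_def chain_boundary_add Modules.additive.add[OF add])
    have "coboundary n X c (singular_face (Suc (Suc n)) k \<sigma>) =
        e (chain_boundary (Suc n) (frag_of (singular_face (Suc (Suc n)) k \<sigma>)))"
      if "k \<le> Suc (Suc n)" for k
      using singular_simplex_singular_face[OF True _ that] by (intro coboundary_eq_extension[OF e]) simp
    then have "coboundary (Suc n) X (coboundary n X c) \<sigma> =
        e (chain_boundary (Suc n) (chain_boundary (Suc (Suc n)) (frag_of \<sigma>)))"
      unfolding additive_chain_boundary_of[OF add'] using True
      by (simp add: coboundary_def del: sum.atMost_Suc cong: if_cong)
    also have "chain_boundary (Suc n) (chain_boundary (Suc (Suc n)) (frag_of \<sigma>)) = 0"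
      using chain_boundary_boundary_alt[of "Suc n" X "frag_of \<sigma>"] True by (simp add: singular_chain_of)
    finally show ?thesis by (simp add: Modules.additive.zero[OF add])
  qed (simp add: coboundary_def)
qed

lemma cocycle_extension_boundary:
  assumes e: "extends_cochain c e" and c: "coboundary n X c = (\<lambda>\<sigma>. 0)"
    and z: "singular_chain (Suc n) X z"
  shows "e (chain_boundary (Suc n) z) = 0"
proof -
  have add: "Modules.additive e" using e by (simp add: extends_cochain_def)
  have "Modules.additive (\<lambda>z. e (chain_boundary (Suc n) z))"
    by (simp add: Modules.additive_def chain_boundary_add Modules.additive.add[OF add])
  moreover have "e (chain_boundary (Suc n) (frag_of \<sigma>)) = 0" if "\<sigma> \<in> Poly_Mapping.keys z" for \<sigma>
    using coboundary_eq_extension[OF e, of n X \<sigma>] c z that by (auto simp: singular_chain_def)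
  ultimately show ?thesis by (rule additive_eq_0)
qed

section \<open>Cocycles that vanish on small simplices\<close>

lemma singular_chain_subdivision_power:
  "singular_chain p X z \<Longrightarrow> singular_chain p X ((singular_subdivision p ^^ i) z)"
  by (induction i) (simp_all add: singular_chain_singular_subdivision)

lemma chain_boundary_subdivision_power:
  assumes "singular_chain (Suc p) X z"
  shows "chain_boundary (Suc p) ((singular_subdivision (Suc p) ^^ i) z) =
    (singular_subdivision p ^^ i) (chain_boundary (Suc p) z)"
proof (induction i)
  case (Suc i)
  show ?case
    using chain_boundary_singular_subdivision[OF singular_chain_subdivision_power[OF assms], of i] Suc
    by simp
qed simp

text \<open>
  Let \<open>h\<close> be the natural homotopy from the identity to the subdivision \<open>sd\<close>. Then
  \<open>H\<^sub>r = \<Sum>i<r. h \<circ> sd\<^sup>i\<close> is a homotopy from the identity to \<open>sd\<^sup>r\<close>. If \<open>r\<close> is so large that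
  \<open>sd\<^sup>r \<sigma>\<close> is small, evaluating \<open>c\<close> on the homotopy formula leaves
  \<open>c \<sigma> = - c (H\<^sub>r (\<partial> \<sigma>))\<close>, because \<open>c\<close> vanishes on boundaries and on small simplices. So
  \<open>\<tau> \<mapsto> - c (H\<^sub>r \<tau>)\<close> would have the coboundary \<open>c\<close>, except that \<open>r\<close> depends on \<open>\<sigma>\<close>. However, once
  \<open>sd\<^sup>i \<tau>\<close> is small for all \<open>i \<ge> N \<tau>\<close>, the value \<open>c (H\<^sub>r \<tau>)\<close> is the same for all \<open>r \<ge> N \<tau>\<close>: by
  naturality \<open>h\<close> maps small chains to small chains. The cochain \<open>\<tau> \<mapsto> - c (H\<^bsub>N \<tau>\<^esub> \<tau>)\<close> therefore works.
\<close>

lemma cocycle_vanishing_on_small_simplices: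
  fixes c :: "('a, 'r::comm_ring) cochain"
  assumes open_cover: "\<And>V. V \<in> \<C> \<Longrightarrow> openin X V" "topspace X \<subseteq> \<Union>\<C>"
    and c: "singular_cochain n X c" "coboundary n X c = (\<lambda>\<sigma>. 0)"
    and small: "\<And>V \<sigma>. V \<in> \<C> \<Longrightarrow> singular_simplex n (subtopology X V) \<sigma> \<Longrightarrow> c \<sigma> = 0"
  shows "c \<in> coboundaries n X"
proof (cases n)
  case 0
  have "c \<sigma> = 0" for \<sigma>
  proof (cases "singular_simplex 0 X \<sigma>")
    case True
    \<comment> \<open>Every \<open>0\<close>-simplex is a point, hence small.\<close>
    define x where "x = \<sigma> (\<lambda>j. if j = 0 then 1 else 0)"
    have "x \<in> topspace X"
      using True by (auto simp: singular_simplex_def continuous_map_def standard_simplex_0 x_def)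
    then obtain V where "V \<in> \<C>" "x \<in> V" using open_cover(2) by blast
    then show ?thesis
      using small[of V \<sigma>] True by (simp add: 0 singular_simplex_subtopology standard_simplex_0 x_def)
  qed (use c 0 in \<open>simp add: singular_cochain_def\<close>)
  then show ?thesis by (simp add: 0 coboundaries_def fun_eq_iff)
next
  case (Suc l)
  obtain e where e: "extends_cochain c e" using ex_extends_cochain .
  have add: "Modules.additive e" and e_of: "\<And>\<sigma>. e (frag_of \<sigma>) = c \<sigma>" using e by (auto simp: extends_cochain_def)
  obtain h where h0: "\<And>p. h p 0 = (0 :: 'a chain)"
    and h_diff: "\<And>p c1 c2. h p (c1 - c2) = h p c1 - h p c2"
    and h_chain: "\<And>p X c. singular_chain p X c \<Longrightarrow> singular_chain (Suc p) X (h p c)"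
    and h_homotopy: "\<And>p X c. singular_chain p X c \<Longrightarrow>
      chain_boundary (Suc p) (h p c) + h (p - Suc 0) (chain_boundary p c) = singular_subdivision p c - c"
    using chain_homotopic_singular_subdivision by metis
  define H where "H = (\<lambda>p r z. \<Sum>i<r. h p ((singular_subdivision p ^^ i) z))"
  have H_diff: "H p r (x - y) = H p r x - H p r y" for p r x y
    by (simp add: H_def singular_subdivision_power_diff h_diff sum_subtractf)
  have H_chain: "singular_chain (Suc p) Y (H p r z)" if "singular_chain p Y z" for p Y r z
    unfolding H_def by (intro singular_chain_sum h_chain singular_chain_subdivision_power that)
  have H_homotopy: "chain_boundary (Suc (Suc l)) (H (Suc l) r z) + H l r (chain_boundary (Suc l) z) =
      (singular_subdivision (Suc l) ^^ r) z - z" if z: "singular_chain (Suc l) X z" for r z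
  proof (induction r)
    case (Suc r)
    let ?A = "chain_boundary (Suc (Suc l)) (h (Suc l) ((singular_subdivision (Suc l) ^^ r) z)) +
        h l ((singular_subdivision l ^^ r) (chain_boundary (Suc l) z))"
    have "?A = (singular_subdivision (Suc l) ^^ Suc r) z - (singular_subdivision (Suc l) ^^ r) z"
      using h_homotopy[OF singular_chain_subdivision_power[OF z], of r]
      by (simp add: chain_boundary_subdivision_power[OF z])
    moreover have "chain_boundary (Suc (Suc l)) (H (Suc l) (Suc r) z) + H l (Suc r) (chain_boundary (Suc l) z) =
        chain_boundary (Suc (Suc l)) (H (Suc l) r z) + H l r (chain_boundary (Suc l) z) + ?A"
      by (simp add: H_def chain_boundary_add add_ac)
    ultimately show ?case
      unfolding Suc.IH by simp
  qed (simp add: H_def)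
  have vanish: "e z = 0" if "singular_chain (Suc l) (subtopology X V) z" "V \<in> \<C>" for z V
  proof (rule additive_eq_0[OF add])
    show "e (frag_of \<sigma>) = 0" if "\<sigma> \<in> Poly_Mapping.keys z" for \<sigma>
      using \<open>singular_chain _ _ z\<close> small[OF \<open>V \<in> \<C>\<close>] that by (auto simp: singular_chain_def e_of Suc)
  qed
  define tiny where "tiny = (\<lambda>p (z :: 'a chain). \<forall>\<sigma>\<in>Poly_Mapping.keys z. \<exists>V\<in>\<C>. singular_simplex p (subtopology X V) \<sigma>)"
  have tiny_power: "\<exists>N. \<forall>i\<ge>N. tiny p ((singular_subdivision p ^^ i) (frag_of \<sigma>))"
    if "singular_simplex p X \<sigma>" for p \<sigma>
  proof -
    have ch: "singular_chain p X (frag_of \<sigma>)" using that by (simp add: singular_chain_of)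
    obtain N where N: "\<And>m f. \<lbrakk>N \<le> m; f \<in> Poly_Mapping.keys ((singular_subdivision p ^^ m) (frag_of \<sigma>))\<rbrakk>
        \<Longrightarrow> \<exists>V \<in> \<C>. f \<in> standard_simplex p \<rightarrow> V"
      using sufficient_iterated_singular_subdivision_exists[OF open_cover ch] by blast
    have "tiny p ((singular_subdivision p ^^ i) (frag_of \<sigma>))" if "i \<ge> N" for i
      unfolding tiny_def
    proof
      fix f assume f: "f \<in> Poly_Mapping.keys ((singular_subdivision p ^^ i) (frag_of \<sigma>))"
      then have "singular_simplex p X f"
        using singular_chain_subdivision_power[OF ch, of i] by (auto simp: singular_chain_def)
      then show "\<exists>V\<in>\<C>. singular_simplex p (subtopology X V) f"
        using N[OF that f] by (auto simp: singular_simplex_subtopology)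
    qed
    then show ?thesis by blast
  qed
  then obtain N where N: "\<And>p \<sigma> i. singular_simplex p X \<sigma> \<Longrightarrow> i \<ge> N p \<sigma> \<Longrightarrow>
      tiny p ((singular_subdivision p ^^ i) (frag_of \<sigma>))"
    by metis
  have eh_tiny: "e (h l z) = 0" if "tiny l z" for z
  proof -
    have "Poly_Mapping.keys z \<subseteq> {\<sigma>. \<exists>V\<in>\<C>. singular_simplex l (subtopology X V) \<sigma>}"
      using that by (auto simp: tiny_def)
    then show ?thesis
    proof (induction rule: frag_induction)
      case (one \<sigma>)
      then obtain V where V: "V \<in> \<C>" "singular_simplex l (subtopology X V) \<sigma>" by blast
      then show ?case using vanish[OF h_chain] by (simp add: singular_chain_of)
    qed (simp_all add: h0 h_diff Modules.additive.zero[OF add] Modules.additive.diff[OF add])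
  qed
  have stable: "e (H l r (frag_of \<tau>)) = e (H l (N l \<tau>) (frag_of \<tau>))"
    if "singular_simplex l X \<tau>" "N l \<tau> \<le> r" for r \<tau>
    using that(2)
  proof (induction r rule: dec_induct)
    case (step r)
    have "e (H l (Suc r) (frag_of \<tau>)) =
        e (H l r (frag_of \<tau>)) + e (h l ((singular_subdivision l ^^ r) (frag_of \<tau>)))"
      by (simp add: H_def Modules.additive.add[OF add])
    then show ?case using step eh_tiny[OF N[OF that(1) step(1)]] by simp
  qed simp
  define b where "b = (\<lambda>\<tau>. if singular_simplex l X \<tau> then - e (H l (N l \<tau>) (frag_of \<tau>)) else 0)"
  have "singular_cochain l X b" by (simp add: singular_cochain_def b_def)
  moreover have "c \<sigma> = coboundary l X b \<sigma>" for \<sigma>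
  proof (cases "singular_simplex (Suc l) X \<sigma>")
    case True
    then have ch: "singular_chain (Suc l) X (frag_of \<sigma>)" by (simp add: singular_chain_of)
    \<comment> \<open>Only a common upper bound of the finitely many thresholds matters; the sum is one.\<close>
    define r where "r = N (Suc l) \<sigma> + (\<Sum>k\<le>Suc l. N l (singular_face (Suc l) k \<sigma>))"
    have face: "singular_simplex l X (singular_face (Suc l) k \<sigma>)" if "k \<le> Suc l" for k
      using singular_simplex_singular_face[OF True _ that] by simp
    have r_face: "N l (singular_face (Suc l) k \<sigma>) \<le> r" if "k \<le> Suc l" for k
      unfolding r_def using that by (intro trans_le_add2 member_le_sum) auto
    have b_face: "b (singular_face (Suc l) k \<sigma>) = - e (H l r (frag_of (singular_face (Suc l) k \<sigma>)))"
      if "k \<le> Suc l" for k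
      using face[OF that] stable[OF face[OF that] r_face[OF that]] by (simp add: b_def)
    have addH: "Modules.additive (\<lambda>z. - e (H l r z))"
    proof -
      \<comment> \<open>Additivity follows from compatibility with differences, as \<open>x + y = x - (0 - y)\<close>.\<close>
      have "H l r (x + y) = H l r x + H l r y" for x y
        using H_diff[of l r x "- y"] H_diff[of l r 0 y] H_diff[of l r 0 0] by simp
      then show ?thesis by (simp add: Modules.additive_def Modules.additive.add[OF add])
    qed
    have "tiny (Suc l) ((singular_subdivision (Suc l) ^^ r) (frag_of \<sigma>))"
      using N[OF True] by (simp add: r_def)
    then have "e ((singular_subdivision (Suc l) ^^ r) (frag_of \<sigma>)) = 0"
      using small by (intro additive_eq_0[OF add, of "(singular_subdivision (Suc l) ^^ r) (frag_of \<sigma>)"])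
        (auto simp: tiny_def e_of Suc)
    moreover have "e (chain_boundary (Suc (Suc l)) (H (Suc l) r (frag_of \<sigma>))) = 0"
      using cocycle_extension_boundary[OF e c(2)] H_chain[OF ch] Suc by simp
    ultimately have "c \<sigma> = - e (H l r (chain_boundary (Suc l) (frag_of \<sigma>)))"
      using arg_cong[OF H_homotopy[OF ch, of r], of e] e_of
      by (simp add: Modules.additive.add[OF add] Modules.additive.diff[OF add])
    also have "\<dots> = coboundary l X b \<sigma>"
      unfolding additive_chain_boundary_of[OF addH] using True b_face
      by (simp add: coboundary_def del: sum.atMost_Suc cong: if_cong)
    finally show ?thesis .
  qed (use c(1) Suc in \<open>simp add: singular_cochain_def coboundary_def\<close>)
  ultimately show ?thesis by (auto simp: Suc coboundaries_def)
qed

section \<open>Cohomology classes\<close>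

lemma coboundaries_zero: "(\<lambda>\<sigma>. 0 :: 'r::comm_ring) \<in> coboundaries n X"
proof (cases n)
  case (Suc l)
  have "singular_cochain l X (\<lambda>\<sigma>. 0 :: 'r)" "coboundary l X (\<lambda>\<sigma>. 0 :: 'r) = (\<lambda>\<sigma>. 0)"
    by (simp_all add: singular_cochain_def coboundary_def fun_eq_iff cong: if_cong)
  then show ?thesis by (force simp: Suc coboundaries_def image_iff)
qed (simp add: coboundaries_def)

lemma coboundary_add:
  "coboundary n X (\<lambda>\<sigma>. c \<sigma> + d \<sigma>) = (\<lambda>\<sigma>. coboundary n X c \<sigma> + coboundary n X d \<sigma>)"
  by (simp add: coboundary_def fun_eq_iff if_distrib sum.distrib[symmetric] del: sum.atMost_Suc)
     (auto intro!: sum.cong)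

lemma coboundary_uminus:
  "coboundary n X (\<lambda>\<sigma>. - c \<sigma>) = (\<lambda>\<sigma>. - coboundary n X c \<sigma>)"
  by (simp add: coboundary_def fun_eq_iff sum_negf[symmetric] del: sum.atMost_Suc)
     (auto intro!: sum.cong)

lemma coboundaries_add:
  assumes "x \<in> coboundaries n X" "y \<in> coboundaries n X"
  shows "(\<lambda>\<sigma>. x \<sigma> + y \<sigma>) \<in> coboundaries n X"
proof (cases n)
  case (Suc l)
  obtain a b where "singular_cochain l X a" "x = coboundary l X a" "singular_cochain l X b" "y = coboundary l X b"
    using assms by (auto simp: Suc coboundaries_def)
  then show ?thesis
    by (auto simp: Suc coboundaries_def coboundary_add singular_cochain_def
        intro!: image_eqI[of _ _ "\<lambda>\<sigma>. a \<sigma> + b \<sigma>"])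
qed (use assms in \<open>simp add: coboundaries_def\<close>)

lemma coboundaries_uminus:
  assumes "x \<in> coboundaries n X" shows "(\<lambda>\<sigma>. - x \<sigma>) \<in> coboundaries n X"
proof (cases n)
  case (Suc l)
  obtain a where "singular_cochain l X a" "x = coboundary l X a"
    using assms by (auto simp: Suc coboundaries_def)
  then show ?thesis
    by (auto simp: Suc coboundaries_def coboundary_uminus singular_cochain_def
        intro!: image_eqI[of _ _ "\<lambda>\<sigma>. - a \<sigma>"])
qed (use assms in \<open>simp add: coboundaries_def\<close>)

definition cocycle :: "nat \<Rightarrow> 'a topology \<Rightarrow> ('a, 'r::comm_ring) cochain \<Rightarrow> bool" where
  "cocycle n X c \<longleftrightarrow> singular_cochain n X c \<and> coboundary n X c = (\<lambda>\<sigma>. 0)"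

lemma cocycle_add: "cocycle n X c \<Longrightarrow> cocycle n X d \<Longrightarrow> cocycle n X (\<lambda>\<sigma>. c \<sigma> + d \<sigma>)"
  by (simp add: cocycle_def singular_cochain_def coboundary_add)

lemma cocycle_uminus: "cocycle n X c \<Longrightarrow> cocycle n X (\<lambda>\<sigma>. - c \<sigma>)"
  by (simp add: cocycle_def singular_cochain_def coboundary_uminus)

lemma coboundaries_imp_cocycle: "x \<in> coboundaries n X \<Longrightarrow> cocycle n X x"
proof (cases n)
  case 0
  assume "x \<in> coboundaries n X"
  then have "x = (\<lambda>\<sigma>. 0)" by (simp add: 0 coboundaries_def)
  then show ?thesis
    by (simp add: cocycle_def singular_cochain_def coboundary_def fun_eq_iff cong: if_cong)
next
  case (Suc l)
  assume "x \<in> coboundaries n X"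
  then obtain a where "x = coboundary l X a" by (auto simp: Suc coboundaries_def)
  then show ?thesis
    by (simp add: Suc cocycle_def coboundary_coboundary) (simp add: singular_cochain_def coboundary_def)
qed

lemma cohomology_class_eq:
  "cohomology_class n X c = (\<lambda>h. (\<lambda>\<sigma>. h \<sigma> + c \<sigma>)) ` coboundaries n X"
  by (auto simp: cohomology_class_def r_coset_def cocycle_group_def)

lemma cohomology_class_cong:
  assumes "(\<lambda>\<sigma>. c \<sigma> - d \<sigma>) \<in> coboundaries n X"
  shows "cohomology_class n X c = cohomology_class n X d"
proof -
  have sub: "cohomology_class n X a \<subseteq> cohomology_class n X b"
    if ab: "(\<lambda>\<sigma>. a \<sigma> - b \<sigma>) \<in> coboundaries n X" for a b
  proof
    fix x assume "x \<in> cohomology_class n X a"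
    then obtain h where h: "h \<in> coboundaries n X" "x = (\<lambda>\<sigma>. h \<sigma> + a \<sigma>)"
      by (auto simp: cohomology_class_eq)
    then have "x = (\<lambda>\<sigma>. (h \<sigma> + (a \<sigma> - b \<sigma>)) + b \<sigma>)" by simp
    then show "x \<in> cohomology_class n X b"
      unfolding cohomology_class_eq using coboundaries_add[OF h(1) ab] by (rule image_eqI)
  qed
  have "(\<lambda>\<sigma>. d \<sigma> - c \<sigma>) \<in> coboundaries n X" using coboundaries_uminus[OF assms] by simp
  then show ?thesis using sub assms by (intro subset_antisym)
qed

lemma mem_own_class: "c \<in> cohomology_class n X c"
  unfolding cohomology_class_eq using coboundaries_zero[of n X] by (intro image_eqI[of _ _ "\<lambda>\<sigma>. 0"]) auto

lemma cohomology_class_coboundary: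
  assumes "c \<in> coboundaries n X" shows "cohomology_class n X c = coboundaries n X"
proof -
  have "cohomology_class n X c = cohomology_class n X (\<lambda>\<sigma>. 0)"
    using assms by (intro cohomology_class_cong) simp
  then show ?thesis by (simp add: cohomology_class_eq)
qed

lemma one_cohomology_group: "\<one>\<^bsub>cohomology_group n X\<^esub> = coboundaries n X"
  by (simp add: cohomology_group_def FactGroup_def)

lemma carrier_cohomology_group:
  assumes "u \<in> carrier (cohomology_group n X)"
  obtains c where "cocycle n X c" "u = cohomology_class n X c"
  using assms
  by (auto simp: cohomology_group_def FactGroup_def RCOSETS_def cohomology_class_def cocycle_def)
     (auto simp: cocycle_group_def)

lemma pullback_class_zero_imp_coboundary:
  assumes "cohomology_pullback n X f (cohomology_class n Y c) = coboundaries n X"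
  shows "cochain_pullback n X f c \<in> coboundaries n X"
  using assms mem_own_class[of c n Y] mem_own_class[of "cochain_pullback n X f c" n X]
  unfolding cohomology_pullback_def by blast

section \<open>Cup products\<close>

text \<open>
  The inclusion of the standard \<open>b\<close>-simplex as the back face of the \<open>(a + b)\<close>-simplex.
\<close>

definition shift :: "nat \<Rightarrow> (nat \<Rightarrow> real) \<Rightarrow> nat \<Rightarrow> real" where
  "shift a x = (\<lambda>i. if i < a then 0 else x (i - a))"

lemma back_face_eq_shift: "back_face a b \<sigma> = restrict (\<sigma> \<circ> shift a) (standard_simplex b)"
  by (simp add: back_face_def shift_def comp_def)

lemma shift_in_simplex:
  assumes "x \<in> standard_simplex b" shows "shift a x \<in> standard_simplex (a + b)"
proof -
  have "(\<Sum>i\<le>a + b. shift a x i) = (\<Sum>i\<in>{a..a + b}. shift a x i)"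
    by (rule sum.mono_neutral_right) (auto simp: shift_def)
  also have "\<dots> = (\<Sum>i\<le>b. shift a x (i + a))"
    using sum.shift_bounds_cl_nat_ivl[of "shift a x" 0 a b] by (simp add: atLeast0AtMost add.commute)
  also have "\<dots> = 1" using assms by (simp add: shift_def standard_simplex_def)
  finally show ?thesis using assms by (auto simp: standard_simplex_def shift_def)
qed

lemma singular_simplex_front_face:
  assumes "singular_simplex (a + b) X \<sigma>" shows "singular_simplex a X (front_face a \<sigma>)"
proof -
  have "continuous_map (subtopology (powertop_real UNIV) (standard_simplex a)) X \<sigma>"
    using assms standard_simplex_mono[of a "a + b"]
    by (auto simp: singular_simplex_def intro: continuous_map_from_subtopology_mono)
  then show ?thesis
    by (auto simp: singular_simplex_def front_face_def intro: continuous_map_eq)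
qed

lemma singular_simplex_back_face:
  assumes "singular_simplex (a + b) X \<sigma>" shows "singular_simplex b X (back_face a b \<sigma>)"
proof -
  have "continuous_map (powertop_real UNIV) (powertop_real UNIV) (shift a)"
    by (auto simp: continuous_map_componentwise_UNIV shift_def intro: continuous_map_product_projection)
  then have "continuous_map (subtopology (powertop_real UNIV) (standard_simplex b))
      (subtopology (powertop_real UNIV) (standard_simplex (a + b))) (shift a)"
    using shift_in_simplex
    by (auto simp: continuous_map_in_subtopology intro: continuous_map_from_subtopology)
  then have "continuous_map (subtopology (powertop_real UNIV) (standard_simplex b)) X (\<sigma> \<circ> shift a)"
    using assms by (auto simp: singular_simplex_def intro: continuous_map_compose)
  then show ?thesis
    unfolding back_face_eq_shift by (auto simp: singular_simplex_def intro: continuous_map_eq)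
qed

lemma front_face_singular_face_le:
  assumes "k \<le> Suc a"
  shows "front_face a (singular_face (Suc (a + b)) k \<sigma>) = singular_face (Suc a) k (front_face (Suc a) \<sigma>)"
proof
  fix x
  show "front_face a (singular_face (Suc (a + b)) k \<sigma>) x = singular_face (Suc a) k (front_face (Suc a) \<sigma>) x"
    using standard_simplex_mono[of a "a + b"] simplical_face_in_standard_simplex[of "Suc a" k x] assms
    by (auto simp: front_face_def singular_face_def)
qed

lemma front_face_singular_face_gt:
  assumes "a < k"
  shows "front_face a (singular_face (Suc (a + b)) k \<sigma>) = front_face a \<sigma>"
proof
  fix x
  have "simplical_face k x = x" if "x \<in> standard_simplex a"
    using that assms by (auto simp: simplical_face_def standard_simplex_def fun_eq_iff)
  then show "front_face a (singular_face (Suc (a + b)) k \<sigma>) x = front_face a \<sigma> x"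
    using standard_simplex_mono[of a "a + b"] by (auto simp: front_face_def singular_face_def)
qed

lemma back_face_singular_face_le:
  assumes "k \<le> a"
  shows "back_face a b (singular_face (Suc (a + b)) k \<sigma>) = back_face (Suc a) b \<sigma>"
proof
  fix x
  have "simplical_face k (shift a x) = shift (Suc a) x"
    using assms by (auto simp: simplical_face_def shift_def fun_eq_iff)
  then show "back_face a b (singular_face (Suc (a + b)) k \<sigma>) x = back_face (Suc a) b \<sigma> x"
    using shift_in_simplex[of x b a] by (simp add: back_face_eq_shift singular_face_def restrict_def)
qed

lemma back_face_singular_face_ge:
  assumes "j \<le> Suc b"
  shows "back_face a b (singular_face (Suc (a + b)) (a + j) \<sigma>) = singular_face (Suc b) j (back_face a (Suc b) \<sigma>)"
proof
  fix x
  have "simplical_face (a + j) (shift a x) = shift a (simplical_face j x)"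
  proof
    fix i
    show "simplical_face (a + j) (shift a x) i = shift a (simplical_face j x) i"
      by (cases "i < a") (auto simp: simplical_face_def shift_def)
  qed
  then show "back_face a b (singular_face (Suc (a + b)) (a + j) \<sigma>) x = singular_face (Suc b) j (back_face a (Suc b) \<sigma>) x"
    using shift_in_simplex[of x b a] simplical_face_in_standard_simplex[of "Suc b" j x] assms
    by (simp add: back_face_eq_shift singular_face_def restrict_def)
qed

text \<open>
  The Leibniz rule \<open>\<delta> (c \<smile> d) = \<delta> c \<smile> d \<plusminus> c \<smile> \<delta> d\<close>. The faces of \<open>\<sigma>\<close> up to index \<open>a\<close> only change its
  front face and the later ones only its back face. The two products on the right-hand side have two
  further terms, from the last face of the front and the first face of the back of \<open>\<sigma>\<close>; these cancel.
\<close>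

lemma coboundary_cup:
  fixes c d :: "('a, 'r::comm_ring) cochain"
  shows "coboundary (a + b) X (cochain_cup X a b c d) \<sigma> =
    cochain_cup X (Suc a) b (coboundary a X c) d \<sigma> +
    (if even a then cochain_cup X a (Suc b) c (coboundary b X d) \<sigma>
     else - cochain_cup X a (Suc b) c (coboundary b X d) \<sigma>)"
proof (cases "singular_simplex (Suc (a + b)) X \<sigma>")
  case True
  define s where "s = (\<lambda>(k::nat) (r :: 'r). if even k then r else - r)"
  let ?f = "front_face (Suc a) \<sigma>" and ?g = "back_face a (Suc b) \<sigma>"
  let ?c = "\<lambda>k. c (singular_face (Suc a) k ?f)" and ?d = "\<lambda>j. d (singular_face (Suc b) j ?g)"
  have s_add: "s (k + l) r = s k (s l r)" for k l r by (simp add: s_def)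
  have s_sum: "s k (\<Sum>i\<in>I. f i) = (\<Sum>i\<in>I. s k (f i))" for k I and f :: "nat \<Rightarrow> 'r"
    by (simp add: s_def sum_negf)
  have s_mult: "s k (x * y) = s k x * y" "s k (x * y) = x * s k y" for k x y by (simp_all add: s_def)
  have f: "singular_simplex (Suc a) X ?f"
    using singular_simplex_front_face[of "Suc a" b X \<sigma>] True by simp
  have g: "singular_simplex (Suc b) X ?g"
    using singular_simplex_back_face[of a "Suc b" X \<sigma>] True by simp
  have c_last: "?c (Suc a) = c (front_face a \<sigma>)"
    using front_face_singular_face_le[of "Suc a" a b \<sigma>] front_face_singular_face_gt[of a "Suc a" b \<sigma>] by simp
  have d_first: "?d 0 = d (back_face (Suc a) b \<sigma>)"
    using back_face_singular_face_le[of a a b \<sigma>] back_face_singular_face_ge[of 0 b a \<sigma>] by simp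
  have "coboundary (a + b) X (cochain_cup X a b c d) \<sigma> =
      (\<Sum>k\<le>Suc (a + b). s k (c (front_face a (singular_face (Suc (a + b)) k \<sigma>)) *
         d (back_face a b (singular_face (Suc (a + b)) k \<sigma>))))"
    using True singular_simplex_singular_face[OF True]
    by (auto simp: coboundary_def cochain_cup_def s_def simp del: sum.atMost_Suc intro!: sum.cong)
  also have "\<dots> = (\<Sum>k\<le>a. s k (c (front_face a (singular_face (Suc (a + b)) k \<sigma>)) *
         d (back_face a b (singular_face (Suc (a + b)) k \<sigma>)))) +
      (\<Sum>j\<in>{1..Suc b}. s (a + j) (c (front_face a (singular_face (Suc (a + b)) (a + j) \<sigma>)) *
         d (back_face a b (singular_face (Suc (a + b)) (a + j) \<sigma>))))" (is "sum ?t _ = _ + _")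
  proof -
    have "{..Suc (a + b)} = {..a} \<union> {a + 1..a + Suc b}" by auto
    then have "sum ?t {..Suc (a + b)} = sum ?t {..a} + sum ?t {a + 1..a + Suc b}"
      by (simp only:) (rule sum.union_disjoint, auto)
    also have "sum ?t {a + 1..a + Suc b} = (\<Sum>j\<in>{1..Suc b}. ?t (a + j))"
      using sum.shift_bounds_cl_nat_ivl[of ?t 1 a "Suc b"] by (simp only: add.commute)
    finally show ?thesis .
  qed
  also have "\<dots> = (\<Sum>k\<le>a. s k (?c k * d (back_face (Suc a) b \<sigma>))) +
      (\<Sum>j\<in>{1..Suc b}. s (a + j) (c (front_face a \<sigma>) * ?d j))"
    by (intro arg_cong2[of _ _ _ _ "(+)"] sum.cong refl)
       (simp_all add: front_face_singular_face_le front_face_singular_face_gt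
         back_face_singular_face_le back_face_singular_face_ge)
  also have "(\<Sum>k\<le>a. s k (?c k * d (back_face (Suc a) b \<sigma>))) =
      (\<Sum>k\<le>Suc a. s k (?c k)) * d (back_face (Suc a) b \<sigma>) +
      s a (c (front_face a \<sigma>) * d (back_face (Suc a) b \<sigma>))"
    by (simp add: c_last sum_distrib_right s_mult(1) distrib_right) (simp add: s_def)
  also have "(\<Sum>j\<in>{1..Suc b}. s (a + j) (c (front_face a \<sigma>) * ?d j)) =
      s a (c (front_face a \<sigma>) * (\<Sum>j\<le>Suc b. s j (?d j))) -
      s a (c (front_face a \<sigma>) * d (back_face (Suc a) b \<sigma>))"
  proof -
    have "{..Suc b} = insert 0 {1..Suc b}" by auto
    then have "(\<Sum>j\<le>Suc b. s j (?d j)) = ?d 0 + (\<Sum>j\<in>{1..Suc b}. s j (?d j))"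
      by (simp add: s_def del: sum.cl_ivl_Suc)
    then show ?thesis
      by (simp add: d_first distrib_left sum_distrib_left s_sum s_add s_mult(2) del: sum.cl_ivl_Suc)
         (simp add: s_def sum_negf del: sum.cl_ivl_Suc)
  qed
  finally show ?thesis
    using True f g by (simp add: cochain_cup_def coboundary_def s_def del: sum.atMost_Suc sum.cl_ivl_Suc)
qed (simp add: coboundary_def cochain_cup_def)

lemma cup_zero_left: "cochain_cup X a b (\<lambda>\<sigma>. 0) d = (\<lambda>\<sigma>. 0)"
  by (simp add: cochain_cup_def fun_eq_iff)

lemma cup_zero_right: "cochain_cup X a b c (\<lambda>\<sigma>. 0) = (\<lambda>\<sigma>. 0)"
  by (simp add: cochain_cup_def fun_eq_iff)

lemma singular_cochain_cup: "singular_cochain (a + b) X (cochain_cup X a b c d)"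
  by (simp add: singular_cochain_def cochain_cup_def)

lemma cocycle_cup:
  assumes "cocycle a X c" "cocycle b X d"
  shows "cocycle (a + b) X (cochain_cup X a b c d)"
proof -
  have "coboundary (a + b) X (cochain_cup X a b c d) = (\<lambda>\<sigma>. 0)"
    by (rule ext) (use assms in \<open>simp add: cocycle_def coboundary_cup cup_zero_left cup_zero_right\<close>)
  then show ?thesis by (simp add: cocycle_def singular_cochain_cup)
qed

lemma coboundary_cup_cocycle:
  assumes h: "h \<in> coboundaries a X" and d: "cocycle b X d"
  shows "cochain_cup X a b h d \<in> coboundaries (a + b) X"
proof (cases a)
  case 0
  then have "h = (\<lambda>\<sigma>. 0)" using h by (simp add: coboundaries_def)
  then show ?thesis by (simp add: cup_zero_left coboundaries_zero)
next
  case (Suc l)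
  obtain e where e: "h = coboundary l X e" using h by (auto simp: Suc coboundaries_def)
  have "cochain_cup X a b h d = coboundary (l + b) X (cochain_cup X l b e d)"
    by (rule ext) (use d in \<open>simp add: coboundary_cup cocycle_def cup_zero_right e Suc\<close>)
  then show ?thesis by (simp add: Suc coboundaries_def singular_cochain_cup)
qed

lemma cocycle_cup_coboundary:
  assumes c: "cocycle a X c" and h: "h \<in> coboundaries b X"
  shows "cochain_cup X a b c h \<in> coboundaries (a + b) X"
proof (cases b)
  case 0
  then have "h = (\<lambda>\<sigma>. 0)" using h by (simp add: coboundaries_def)
  then show ?thesis by (simp add: cup_zero_right coboundaries_zero)
next
  case (Suc l)
  obtain e where e: "h = coboundary l X e" using h by (auto simp: Suc coboundaries_def)
  let ?z = "cochain_cup X a l c e"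
  have "coboundary (a + l) X ?z = (\<lambda>\<sigma>. if even a then cochain_cup X a b c h \<sigma> else - cochain_cup X a b c h \<sigma>)"
    by (rule ext) (use c in \<open>simp add: coboundary_cup cocycle_def cup_zero_left e Suc\<close>)
  moreover have z: "coboundary (a + l) X ?z \<in> coboundaries (a + b) X"
    by (simp add: Suc coboundaries_def singular_cochain_cup)
  ultimately show ?thesis
    using coboundaries_uminus[OF z] by (cases "even a") auto
qed

text \<open>
  Any two products of representatives differ by products of a coboundary and a cocycle, which are
  coboundaries by the Leibniz rule. So the union that defines the product of the
  classes is a union of copies of a single class.
\<close>

lemma cup_classes:
  assumes c: "cocycle a X c" and d: "cocycle b X d"
  shows "cup X a b (cohomology_class a X c) (cohomology_class b X d) =
    cohomology_class (a + b) X (cochain_cup X a b c d)"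
proof -
  have "cohomology_class (a + b) X (cochain_cup X a b c' d') = cohomology_class (a + b) X (cochain_cup X a b c d)"
    if c': "c' \<in> cohomology_class a X c" and d': "d' \<in> cohomology_class b X d" for c' d'
  proof -
    obtain h where h: "h \<in> coboundaries a X" "c' = (\<lambda>\<sigma>. h \<sigma> + c \<sigma>)"
      using c' by (auto simp: cohomology_class_eq)
    obtain g where g: "g \<in> coboundaries b X" "d' = (\<lambda>\<sigma>. g \<sigma> + d \<sigma>)"
      using d' by (auto simp: cohomology_class_eq)
    have d'': "cocycle b X d'" using g d by (simp add: cocycle_add coboundaries_imp_cocycle)
    have "(\<lambda>\<sigma>. cochain_cup X a b c' d' \<sigma> - cochain_cup X a b c d \<sigma>) =
        (\<lambda>\<sigma>. cochain_cup X a b h d' \<sigma> + cochain_cup X a b c g \<sigma>)"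
      by (simp add: h(2) g(2) cochain_cup_def fun_eq_iff algebra_simps)
    also have "\<dots> \<in> coboundaries (a + b) X"
      by (rule coboundaries_add[OF coboundary_cup_cocycle[OF h(1) d''] cocycle_cup_coboundary[OF c g(1)]])
    finally show ?thesis by (rule cohomology_class_cong)
  qed
  then show ?thesis
    unfolding cup_def using mem_own_class[of c a X] mem_own_class[of d b X] by blast
qed

section \<open>Faces of standard simplices\<close>

text \<open>
  A face of a standard simplex is given by the set \<open>S\<close> of its vertices, listed in increasing order by
  \<open>vertex S\<close>. The map \<open>spread S\<close> is the affine inclusion of the standard simplex with \<open>card S\<close>
  vertices as this face, and \<open>pick S\<close> reads off the coordinates at the vertices in \<open>S\<close>. The two are defined
  on all sequences, which makes them total linear maps; they are inverse to each other only between sequences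
  supported below \<open>card S\<close> and sequences supported in \<open>S\<close>.
\<close>

definition vertex :: "nat set \<Rightarrow> nat \<Rightarrow> nat" where
  "vertex S j = sorted_list_of_set S ! j"

lemma vertex_bij_betw: "finite S \<Longrightarrow> bij_betw (vertex S) {..<card S} S"
  unfolding vertex_def using bij_betw_nth[of "sorted_list_of_set S" "{..<card S}" S] by simp

lemma vertex_in: "finite S \<Longrightarrow> j < card S \<Longrightarrow> vertex S j \<in> S"
  using vertex_bij_betw[of S] by (auto simp: bij_betw_def)

lemma vertex_inj: "finite S \<Longrightarrow> inj_on (vertex S) {..<card S}"
  using vertex_bij_betw by (auto simp: bij_betw_def)

lemma vertex_surj:
  assumes "finite S" "i \<in> S" obtains j where "j < card S" "i = vertex S j"
proof -
  have "vertex S ` {..<card S} = S"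
    using vertex_bij_betw[OF assms(1)] by (auto simp: bij_betw_def)
  then show thesis using that assms(2) by blast
qed

lemma vertex_less: "finite S \<Longrightarrow> i < j \<Longrightarrow> j < card S \<Longrightarrow> vertex S i < vertex S j"
  unfolding vertex_def
  using strict_sorted_list_of_set[of S] by (simp add: sorted_wrt_iff_nth_less)

lemma vertex_unique:
  assumes "\<And>i j. i < j \<Longrightarrow> j < n \<Longrightarrow> e i < (e j :: nat)" "e ` {..<n} = S" "j < n"
  shows "vertex S j = e j"
proof -
  have "sorted_wrt (<) (map e [0..<n])"
    using assms(1) by (auto simp: sorted_wrt_iff_nth_less)
  moreover have "set (map e [0..<n]) = S" using assms(2) by (auto simp: atLeast0LessThan)
  ultimately have "sorted_list_of_set S = map e [0..<n]"
    by (metis List.finite_set set_sorted_list_of_set strict_sorted_equal strict_sorted_list_of_set)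
  then show ?thesis using assms(3) by (simp add: vertex_def)
qed

lemma vertex_lessThan: "j < n \<Longrightarrow> vertex {..<n} j = j"
  by (rule vertex_unique[where n = n and e = "\<lambda>i. i"]) auto

lemma card_vertex_image: "finite T \<Longrightarrow> S \<subseteq> {..<card T} \<Longrightarrow> card (vertex T ` S) = card S"
  by (meson card_image inj_on_subset vertex_inj)

lemma vertex_image_subset: "finite T \<Longrightarrow> S \<subseteq> {..<card T} \<Longrightarrow> vertex T ` S \<subseteq> T"
  using vertex_in by blast

text \<open>
  A face of a face: the composite of two increasing enumerations is increasing, hence is the
  enumeration of its image. All compatibilities of \<open>spread\<close> and \<open>pick\<close> below rest on this.
\<close>

lemma vertex_vertex_image:
  assumes T: "finite T" and S: "S \<subseteq> {..<card T}" and j: "j < card S"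
  shows "vertex (vertex T ` S) j = vertex T (vertex S j)"
proof -
  have fS: "finite S" using S finite_subset by blast
  have "vertex S ` {..<card S} = S"
    using vertex_bij_betw[OF fS] by (auto simp: bij_betw_def)
  then have "(\<lambda>i. vertex T (vertex S i)) ` {..<card S} = vertex T ` S"
    by (metis image_image)
  moreover have "vertex T (vertex S i) < vertex T (vertex S k)" if "i < k" "k < card S" for i k
    using vertex_less[OF T vertex_less[OF fS that]] vertex_in[OF fS that(2)] S by auto
  ultimately show ?thesis using j by (intro vertex_unique) auto
qed

definition pick :: "nat set \<Rightarrow> (nat \<Rightarrow> real) \<Rightarrow> nat \<Rightarrow> real" where
  "pick S x = (\<lambda>j. if j < card S then x (vertex S j) else 0)"

definition spread :: "nat set \<Rightarrow> (nat \<Rightarrow> real) \<Rightarrow> nat \<Rightarrow> real" where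
  "spread S y = (\<lambda>i. if i \<in> S then y (the_inv_into {..<card S} (vertex S) i) else 0)"

lemma spread_vertex [simp]: "finite S \<Longrightarrow> j < card S \<Longrightarrow> spread S y (vertex S j) = y j"
  by (simp add: spread_def vertex_in the_inv_into_f_f vertex_inj)

lemma spread_outside [simp]: "i \<notin> S \<Longrightarrow> spread S y i = 0"
  by (simp add: spread_def)

lemma eq_spreadI:
  assumes "finite S" "\<And>i. i \<notin> S \<Longrightarrow> x i = 0" "\<And>j. j < card S \<Longrightarrow> x (vertex S j) = y j"
  shows "x = spread S y"
proof
  fix i show "x i = spread S y i"
    using assms(2,3)[of i] assms(1,3) vertex_surj[OF assms(1), of i] by (metis spread_outside spread_vertex)
qed

lemma spread_pick: "finite S \<Longrightarrow> {i. x i \<noteq> 0} \<subseteq> S \<Longrightarrow> spread S (pick S x) = x"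
  by (rule eq_spreadI[symmetric]) (auto simp: pick_def)

lemma pick_spread: "finite S \<Longrightarrow> {i. y i \<noteq> 0} \<subseteq> {..<card S} \<Longrightarrow> pick S (spread S y) = y"
  by (auto simp: pick_def fun_eq_iff)

lemma spread_spread:
  assumes T: "finite T" and S: "S \<subseteq> {..<card T}"
  shows "spread T (spread S y) = spread (vertex T ` S) y"
proof (rule eq_spreadI)
  have fS: "finite S" using S finite_subset by blast
  then show "finite (vertex T ` S)" by simp
  show "spread T (spread S y) i = 0" if "i \<notin> vertex T ` S" for i
  proof (cases "i \<in> T")
    case True
    then obtain j where "j < card T" "i = vertex T j" using vertex_surj[OF T] by blast
    moreover from this have "j \<notin> S" using that by blast
    ultimately show ?thesis using T by simp
  qed simp
  show "spread T (spread S y) (vertex (vertex T ` S) j) = y j" if "j < card (vertex T ` S)" for j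
  proof -
    have j: "j < card S" using that by (simp add: card_vertex_image[OF T S])
    then have "vertex S j < card T" using vertex_in[OF fS j] S by auto
    then show ?thesis using j fS T by (simp add: vertex_vertex_image[OF T S])
  qed
qed

lemma pick_pick:
  assumes T: "finite T" and S: "S \<subseteq> {..<card T}"
  shows "pick S (pick T x) = pick (vertex T ` S) x"
  using S vertex_in[of S] finite_subset[OF S]
  by (auto simp: pick_def fun_eq_iff card_vertex_image[OF T S] vertex_vertex_image[OF T S])

lemma pick_image_spread:
  assumes T: "finite T" and S: "S \<subseteq> {..<card T}" and y: "{i. y i \<noteq> 0} \<subseteq> {..<card T}"
  shows "pick (vertex T ` S) (spread T y) = pick S y"
  by (metis T S y pick_pick pick_spread)

lemma supp_spread:
  assumes T: "finite T" and y: "{i. y i \<noteq> 0} \<subseteq> {..<card T}"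
  shows "{i. spread T y i \<noteq> 0} = vertex T ` {i. y i \<noteq> 0}"
proof (intro equalityI subsetI)
  fix i assume i: "i \<in> {i. spread T y i \<noteq> 0}"
  then have "i \<in> T" using spread_outside by blast
  then obtain j where "j < card T" "i = vertex T j" using vertex_surj[OF T] by blast
  then show "i \<in> vertex T ` {i. y i \<noteq> 0}"
    using i T by auto
qed (use y T in auto)

lemma sum_spread:
  assumes S: "finite S" "S \<subseteq> {..n}"
  shows "(\<Sum>i\<le>n. spread S y i) = (\<Sum>j<card S. y j)"
proof -
  have "(\<Sum>i\<le>n. spread S y i) = (\<Sum>i\<in>S. spread S y i)"
    using S by (intro sum.mono_neutral_right) auto
  also have "\<dots> = (\<Sum>j<card S. spread S y (vertex S j))"
    using sum.reindex_bij_betw[OF vertex_bij_betw[OF S(1)]] by metis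
  finally show ?thesis using S by simp
qed

lemma lessThan_card: "finite S \<Longrightarrow> S \<noteq> {} \<Longrightarrow> {..<card S} = {..card S - Suc 0}"
  by (cases "card S") (auto simp: lessThan_Suc_atMost)

lemma supp_standard_simplex: "x \<in> standard_simplex n \<Longrightarrow> {i. x i \<noteq> 0} \<subseteq> {..n}"
  by (auto simp: standard_simplex_def) (meson not_le)

lemma supp_nonempty: "x \<in> standard_simplex n \<Longrightarrow> {i. x i \<noteq> 0} \<noteq> {}"
proof
  assume "x \<in> standard_simplex n" "{i. x i \<noteq> 0} = {}"
  then have "(\<Sum>i\<le>n. x i) = 1" "\<And>i. x i = 0" by (auto simp: standard_simplex_def)
  then show False by simp
qed

lemma spread_in_simplex:
  assumes S: "S \<subseteq> {..n}" "S \<noteq> {}" and y: "y \<in> standard_simplex (card S - Suc 0)"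
  shows "spread S y \<in> standard_simplex n"
proof -
  have fS: "finite S" using S finite_subset by blast
  have "0 \<le> spread S y i \<and> spread S y i \<le> 1" for i
    using y by (simp add: spread_def standard_simplex_def)
  moreover have "spread S y i = 0" if "i > n" for i
    using that S by (intro spread_outside) auto
  moreover have "(\<Sum>i\<le>n. spread S y i) = 1"
    using y by (simp add: sum_spread[OF fS S(1)] lessThan_card[OF fS S(2)] standard_simplex_def)
  ultimately show ?thesis by (auto simp: standard_simplex_def)
qed

lemma pick_in_simplex:
  assumes x: "x \<in> standard_simplex n" and S: "finite S" "{i. x i \<noteq> 0} \<subseteq> S"
  shows "pick S x \<in> standard_simplex (card S - Suc 0)"
proof -
  have ne: "S \<noteq> {}" using supp_nonempty[OF x] S by auto
  have "0 < card S" using ne S card_gt_0_iff by blast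
  have "(\<Sum>j<card S. pick S x j) = (\<Sum>i\<le>n + Max S. spread S (pick S x) i)"
    by (subst sum_spread) (use S in \<open>auto intro: trans_le_add2\<close>)
  also have "\<dots> = (\<Sum>i\<le>n + Max S. x i)" using S by (simp add: spread_pick)
  also have "\<dots> = (\<Sum>i\<le>n. x i)"
    using supp_standard_simplex[OF x] by (intro sum.mono_neutral_right) auto
  finally have "(\<Sum>j\<le>card S - Suc 0. pick S x j) = 1"
    using x by (simp add: lessThan_card[OF S(1) ne] standard_simplex_def)
  then show ?thesis using x \<open>0 < card S\<close> by (auto simp: standard_simplex_def pick_def)
qed

lemma continuous_map_spread:
  "continuous_map (powertop_real UNIV) (powertop_real UNIV) (spread S)"
  by (auto simp: continuous_map_componentwise_UNIV spread_def intro: continuous_map_product_projection)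

lemma continuous_map_pick:
  "continuous_map (powertop_real UNIV) (powertop_real UNIV) (pick S)"
  by (auto simp: continuous_map_componentwise_UNIV pick_def intro: continuous_map_product_projection)

section \<open>The skeleta of the singular complex\<close>

text \<open>
  Gluing the standard simplices that belong to the singular simplices of \<open>X\<close> along their faces identifies a
  point of such a simplex with a point in the interior of the face that carries it. So the glued space is the
  disjoint union of the open simplices, a point being a pair \<open>(\<tau>, y)\<close> with \<open>y\<close> in the interior of the
  standard simplex that \<open>\<tau>\<close> is defined on. The characteristic map \<open>cell \<sigma>\<close> sends \<open>x\<close> to the face of \<open>\<sigma>\<close>
  spanned by the support of \<open>x\<close>, with the nonzero coordinates of \<open>x\<close>. Degenerate singular simplices
  are not collapsed.
\<close>

definition open_simplex :: "nat \<Rightarrow> (nat \<Rightarrow> real) set" where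
  "open_simplex n = {x \<in> standard_simplex n. {i. x i \<noteq> 0} = {..n}}"

abbreviation simplex_space :: "nat \<Rightarrow> (nat \<Rightarrow> real) topology" where
  "simplex_space n \<equiv> subtopology (powertop_real UNIV) (standard_simplex n)"

definition subsimplex :: "nat set \<Rightarrow> ((nat \<Rightarrow> real) \<Rightarrow> 'a) \<Rightarrow> (nat \<Rightarrow> real) \<Rightarrow> 'a" where
  "subsimplex S \<sigma> = restrict (\<sigma> \<circ> spread S) (standard_simplex (card S - Suc 0))"

definition cell :: "((nat \<Rightarrow> real) \<Rightarrow> 'a) \<Rightarrow> (nat \<Rightarrow> real) \<Rightarrow> ((nat \<Rightarrow> real) \<Rightarrow> 'a) \<times> (nat \<Rightarrow> real)" where
  "cell \<sigma> x = (subsimplex {i. x i \<noteq> 0} \<sigma>, pick {i. x i \<noteq> 0} x)"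

lemma subsimplex_singular_simplex:
  assumes S: "S \<subseteq> {..n}" "S \<noteq> {}" and \<sigma>: "singular_simplex n X \<sigma>"
  shows "singular_simplex (card S - Suc 0) X (subsimplex S \<sigma>)"
proof -
  have "continuous_map (simplex_space (card S - Suc 0)) (simplex_space n) (spread S)"
    using continuous_map_spread spread_in_simplex[OF S]
    by (auto simp: continuous_map_in_subtopology intro: continuous_map_from_subtopology)
  with \<sigma> have "continuous_map (simplex_space (card S - Suc 0)) X (\<sigma> \<circ> spread S)"
    by (auto simp: singular_simplex_def intro: continuous_map_compose)
  then show ?thesis
    by (simp add: singular_simplex_def subsimplex_def continuous_map_eq[of _ _ "\<sigma> \<circ> spread S"])
qed

lemma subsimplex_subsimplex:
  assumes T: "finite T" and S: "S \<subseteq> {..<card T}" "S \<noteq> {}"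
  shows "subsimplex S (subsimplex T \<sigma>) = subsimplex (vertex T ` S) \<sigma>"
proof
  fix y
  have "T \<noteq> {}" using S by auto
  then have "S \<subseteq> {..card T - Suc 0}" using S(1) lessThan_card[OF T] by simp
  then have "y \<in> standard_simplex (card S - Suc 0) \<Longrightarrow> spread S y \<in> standard_simplex (card T - Suc 0)"
    using spread_in_simplex S by blast
  then show "subsimplex S (subsimplex T \<sigma>) y = subsimplex (vertex T ` S) \<sigma> y"
    by (simp add: subsimplex_def card_vertex_image[OF T S(1)] spread_spread[OF T S(1)] restrict_def)
qed

text \<open>
  The characteristic maps are compatible with faces, because the support of \<open>spread S y\<close> consists of the
  vertices of \<open>S\<close> indexed by the support of \<open>y\<close>.
\<close>

lemma cell_subsimplex:
  assumes S: "S \<subseteq> {..n}" "S \<noteq> {}" and y: "y \<in> standard_simplex (card S - Suc 0)"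
  shows "cell (subsimplex S \<sigma>) y = cell \<sigma> (spread S y)"
proof -
  have fS: "finite S" using S finite_subset by blast
  have supp: "{i. y i \<noteq> 0} \<subseteq> {..<card S}"
    using supp_standard_simplex[OF y] lessThan_card[OF fS S(2)] by simp
  show ?thesis
    unfolding cell_def supp_spread[OF fS supp]
    using fS supp supp_nonempty[OF y] by (simp only: subsimplex_subsimplex pick_image_spread not_False_eq_True)
qed

lemma cell_interior:
  assumes "x \<in> open_simplex n" "\<sigma> \<in> extensional (standard_simplex n)"
  shows "cell \<sigma> x = (\<sigma>, x)"
proof -
  have spr: "spread {..n} y = y" if "y \<in> standard_simplex n" for y
    using that by (intro eq_spreadI[symmetric])
      (auto simp: standard_simplex_def vertex_lessThan simp flip: lessThan_Suc_atMost)
  have "pick {..n} x = x"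
    using assms by (auto simp: pick_def open_simplex_def standard_simplex_def fun_eq_iff
      vertex_lessThan simp flip: lessThan_Suc_atMost)
  moreover have "subsimplex {..n} \<sigma> = \<sigma>"
    by (rule ext) (simp add: subsimplex_def restrict_def spr extensional_arb[OF assms(2)])
  ultimately show ?thesis using assms(1) by (simp add: cell_def open_simplex_def)
qed

lemma pick_support_in_open_simplex:
  assumes x: "x \<in> standard_simplex n"
  shows "pick {i. x i \<noteq> 0} x \<in> open_simplex (card {i. x i \<noteq> 0} - Suc 0)"
proof -
  have fin: "finite {i. x i \<noteq> 0}" using supp_standard_simplex[OF x] finite_subset by blast
  then have "{i. pick {i. x i \<noteq> 0} x i \<noteq> 0} = {..<card {i. x i \<noteq> 0}}"
    using vertex_in[of "{i. x i \<noteq> 0}"] by (auto simp: pick_def)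
  then show ?thesis
    using pick_in_simplex[OF x fin] lessThan_card[OF fin supp_nonempty[OF x]]
    by (simp add: open_simplex_def)
qed

definition skeleton_points ::
  "nat \<Rightarrow> 'a topology \<Rightarrow> (((nat \<Rightarrow> real) \<Rightarrow> 'a) \<times> (nat \<Rightarrow> real)) set" where
  "skeleton_points m X = {(\<tau>, y). \<exists>n\<le>m. singular_simplex n X \<tau> \<and> y \<in> open_simplex n}"

text \<open>
  The final topology for the characteristic maps of dimension at most \<open>m\<close>.
\<close>

definition skeleton ::
  "nat \<Rightarrow> 'a topology \<Rightarrow> (((nat \<Rightarrow> real) \<Rightarrow> 'a) \<times> (nat \<Rightarrow> real)) topology" where
  "skeleton m X = topology (\<lambda>W. W \<subseteq> skeleton_points m X \<and>
     (\<forall>n\<le>m. \<forall>\<sigma>. singular_simplex n X \<sigma> \<longrightarrow>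
        openin (simplex_space n) {x \<in> standard_simplex n. cell \<sigma> x \<in> W}))"

lemma supp_card_le:
  assumes x: "x \<in> standard_simplex n" shows "card {i. x i \<noteq> 0} - Suc 0 \<le> n"
  using card_mono[OF _ supp_standard_simplex[OF x]] by simp

lemma cell_in_skeleton_points:
  assumes "singular_simplex n X \<sigma>" "n \<le> m" "x \<in> standard_simplex n"
  shows "cell \<sigma> x \<in> skeleton_points m X"
proof -
  let ?S = "{i. x i \<noteq> 0}"
  have "singular_simplex (card ?S - Suc 0) X (subsimplex ?S \<sigma>)"
    by (rule subsimplex_singular_simplex[OF supp_standard_simplex supp_nonempty assms(1)]) fact+
  moreover have "card ?S - Suc 0 \<le> m" using supp_card_le[OF assms(3)] assms(2) by linarith
  moreover have "pick ?S x \<in> open_simplex (card ?S - Suc 0)"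
    by (rule pick_support_in_open_simplex) fact
  ultimately show ?thesis unfolding skeleton_points_def cell_def by blast
qed

lemma openin_skeleton:
  "openin (skeleton m X) W \<longleftrightarrow> W \<subseteq> skeleton_points m X \<and>
     (\<forall>n\<le>m. \<forall>\<sigma>. singular_simplex n X \<sigma> \<longrightarrow>
        openin (simplex_space n) {x \<in> standard_simplex n. cell \<sigma> x \<in> W})"
proof -
  have "istopology (\<lambda>W. W \<subseteq> skeleton_points m X \<and>
     (\<forall>n\<le>m. \<forall>\<sigma>. singular_simplex n X \<sigma> \<longrightarrow>
        openin (simplex_space n) {x \<in> standard_simplex n. cell \<sigma> x \<in> W}))" (is "istopology ?Q")
    unfolding istopology_def
  proof (intro conjI allI impI)
    fix S T assume "?Q S" "?Q T"
    moreover have "{x \<in> standard_simplex n. cell \<sigma> x \<in> S \<inter> T} =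
        {x \<in> standard_simplex n. cell \<sigma> x \<in> S} \<inter> {x \<in> standard_simplex n. cell \<sigma> x \<in> T}"
      for n and \<sigma> :: "(nat \<Rightarrow> real) \<Rightarrow> 'a"
      by auto
    ultimately show "S \<inter> T \<subseteq> skeleton_points m X"
      and "\<And>n \<sigma>. n \<le> m \<Longrightarrow> singular_simplex n X \<sigma> \<Longrightarrow>
        openin (simplex_space n) {x \<in> standard_simplex n. cell \<sigma> x \<in> S \<inter> T}"
      by (auto simp only: intro!: openin_Int)
  next
    fix \<K> assume "\<forall>K\<in>\<K>. ?Q K"
    moreover have "{x \<in> standard_simplex n. cell \<sigma> x \<in> \<Union>\<K>} =
        \<Union>((\<lambda>K. {x \<in> standard_simplex n. cell \<sigma> x \<in> K}) ` \<K>)"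
      for n and \<sigma> :: "(nat \<Rightarrow> real) \<Rightarrow> 'a"
      by auto
    ultimately show "\<Union>\<K> \<subseteq> skeleton_points m X"
      and "\<And>n \<sigma>. n \<le> m \<Longrightarrow> singular_simplex n X \<sigma> \<Longrightarrow>
        openin (simplex_space n) {x \<in> standard_simplex n. cell \<sigma> x \<in> \<Union>\<K>}"
      by (auto simp only: intro!: openin_Union)
  qed
  then show ?thesis unfolding skeleton_def by (simp add: topology_inverse')
qed

lemma topspace_skeleton [simp]: "topspace (skeleton m X) = skeleton_points m X"
proof -
  have "{x \<in> standard_simplex n. cell \<sigma> x \<in> skeleton_points m X} = topspace (simplex_space n)"
    if "n \<le> m" "singular_simplex n X \<sigma>" for n \<sigma>
    using cell_in_skeleton_points[OF that(2,1)] by auto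
  then have *: "openin (simplex_space n) {x \<in> standard_simplex n. cell \<sigma> x \<in> skeleton_points m X}"
    if "n \<le> m" "singular_simplex n X \<sigma>" for n \<sigma>
    using that openin_topspace[of "simplex_space n"] by simp
  have "openin (skeleton m X) (skeleton_points m X)"
    unfolding openin_skeleton by (intro conjI allI impI order_refl *)
  moreover have "topspace (skeleton m X) \<subseteq> skeleton_points m X"
    using openin_topspace[of "skeleton m X"] unfolding openin_skeleton by (rule conjunct1)
  ultimately show ?thesis
    using openin_subset by blast
qed

lemma closedin_skeleton:
  assumes "A \<subseteq> skeleton_points m X"
  shows "closedin (skeleton m X) A \<longleftrightarrow> (\<forall>n\<le>m. \<forall>\<sigma>. singular_simplex n X \<sigma> \<longrightarrow>
        closedin (simplex_space n) {x \<in> standard_simplex n. cell \<sigma> x \<in> A})"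
proof -
  have "openin (simplex_space n) {x \<in> standard_simplex n. cell \<sigma> x \<in> skeleton_points m X - A} \<longleftrightarrow>
      closedin (simplex_space n) {x \<in> standard_simplex n. cell \<sigma> x \<in> A}"
    if "n \<le> m" "singular_simplex n X \<sigma>" for n \<sigma>
  proof -
    have "{x \<in> standard_simplex n. cell \<sigma> x \<in> skeleton_points m X - A} =
        standard_simplex n - {x \<in> standard_simplex n. cell \<sigma> x \<in> A}"
      using cell_in_skeleton_points[OF that(2,1)] by auto
    then show ?thesis by (simp add: closedin_def)
  qed
  then show ?thesis
    using assms unfolding closedin_def[of "skeleton m X"] openin_skeleton topspace_skeleton by blast
qed

lemma continuous_map_cell:
  assumes "singular_simplex n X \<sigma>" "n \<le> m"
  shows "continuous_map (simplex_space n) (skeleton m X) (cell \<sigma>)"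
  unfolding continuous_map_def topspace_skeleton topspace_standard_simplex
  using cell_in_skeleton_points[OF assms] assms unfolding openin_skeleton by blast

lemma continuous_map_from_skeleton:
  assumes "\<And>n \<sigma>. n \<le> m \<Longrightarrow> singular_simplex n X \<sigma> \<Longrightarrow>
      continuous_map (simplex_space n) Y (f \<circ> cell \<sigma>)"
  shows "continuous_map (skeleton m X) Y f"
  unfolding continuous_map_def
proof (intro conjI allI impI)
  show "f \<in> topspace (skeleton m X) \<rightarrow> topspace Y"
  proof clarsimp
    fix \<tau> y assume "(\<tau>, y) \<in> skeleton_points m X"
    then obtain n where n: "n \<le> m" "singular_simplex n X \<tau>" "y \<in> open_simplex n"
      by (auto simp: skeleton_points_def)
    then have "cell \<tau> y = (\<tau>, y)" "y \<in> standard_simplex n"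
      by (auto simp: cell_interior singular_simplex_def) (simp add: open_simplex_def)
    then show "f (\<tau>, y) \<in> topspace Y"
      using assms[OF n(1,2)] by (force simp: continuous_map_def)
  qed
  fix W assume "openin Y W"
  then have "openin (simplex_space n) {x \<in> standard_simplex n. f (cell \<sigma> x) \<in> W}"
    if "n \<le> m" "singular_simplex n X \<sigma>" for n \<sigma>
    using assms[OF that] by (simp add: continuous_map_def)
  moreover have "{x \<in> standard_simplex n. cell \<sigma> x \<in> {x \<in> skeleton_points m X. f x \<in> W}} =
      {x \<in> standard_simplex n. f (cell \<sigma> x) \<in> W}"
    if "n \<le> m" "singular_simplex n X \<sigma>" for n \<sigma>
    using cell_in_skeleton_points[OF that(2,1)] by auto
  ultimately show "openin (skeleton m X) {x \<in> topspace (skeleton m X). f x \<in> W}"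
    by (simp add: openin_skeleton)
qed

section \<open>Separating points of the skeleta\<close>

text \<open>
  The skeleta are Hausdorff because continuous real functions separate their points. Fix a singular
  \<open>l\<close>-simplex \<open>\<tau>\<close>. On the simplex that belongs to \<open>\<sigma>\<close>, consider the sum, over all faces \<open>S\<close> of \<open>\<sigma>\<close> that
  equal \<open>\<tau>\<close> as singular simplices, of \<open>(\<Prod>i\<in>S. x i) * x s\<close>, with \<open>s\<close> the \<open>j\<close>-th vertex of \<open>S\<close>. A summand
  vanishes unless \<open>S\<close> is contained in the support of \<open>x\<close>, so the sum depends only on the face that carries
  \<open>x\<close>. Hence these polynomials fit together to a function on the skeleton.
\<close>

definition faces_equal ::
  "nat set \<Rightarrow> ((nat \<Rightarrow> real) \<Rightarrow> 'a) \<Rightarrow> nat \<Rightarrow> ((nat \<Rightarrow> real) \<Rightarrow> 'a) \<Rightarrow> nat set set" where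
  "faces_equal T \<sigma> l \<tau> = {S. S \<subseteq> T \<and> card S = Suc l \<and> subsimplex S \<sigma> = \<tau>}"

definition bump ::
  "nat \<Rightarrow> ((nat \<Rightarrow> real) \<Rightarrow> 'a) \<Rightarrow> nat \<Rightarrow> ((nat \<Rightarrow> real) \<Rightarrow> 'a) \<Rightarrow> (nat \<Rightarrow> real) \<Rightarrow> real" where
  "bump l \<tau> j \<sigma> x = (\<Sum>S\<in>faces_equal {i. x i \<noteq> 0} \<sigma> l \<tau>. (\<Prod>i\<le>l. pick S x i) * pick S x j)"

lemma prod_pick_eq_0:
  assumes "card S = Suc l" "\<not> S \<subseteq> {i. x i \<noteq> 0}"
  shows "(\<Prod>i\<le>l. pick S x i) = 0"
proof -
  obtain i where i: "i \<in> S" "x i = 0" using assms(2) by blast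
  have "finite S" using assms(1) by (intro card_ge_0_finite) simp
  then obtain k where "k < card S" "i = vertex S k" using vertex_surj[OF _ i(1)] by metis
  then have "k \<le> l" "pick S x k = 0" using assms(1) i(2) by (auto simp: pick_def)
  then show ?thesis by (meson atMost_iff finite_atMost prod_zero)
qed

text \<open>
  Summing over the support of \<open>x\<close> makes \<open>bump\<close> meaningful on the points of the skeleton, and summing over all
  faces of the simplex makes it visibly a polynomial.
\<close>

lemma bump_on_simplex:
  assumes "x \<in> standard_simplex n"
  shows "bump l \<tau> j \<sigma> x = (\<Sum>S\<in>faces_equal {..n} \<sigma> l \<tau>. (\<Prod>i\<le>l. pick S x i) * pick S x j)"
  unfolding bump_def
proof (rule sum.mono_neutral_left)
  show "finite (faces_equal {..n} \<sigma> l \<tau>)"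
    by (rule finite_subset[of _ "Pow {..n}"]) (auto simp: faces_equal_def)
  show "faces_equal {i. x i \<noteq> 0} \<sigma> l \<tau> \<subseteq> faces_equal {..n} \<sigma> l \<tau>"
    using supp_standard_simplex[OF assms] by (auto simp: faces_equal_def)
  show "\<forall>S\<in>faces_equal {..n} \<sigma> l \<tau> - faces_equal {i. x i \<noteq> 0} \<sigma> l \<tau>.
      (\<Prod>i\<le>l. pick S x i) * pick S x j = 0"
    using prod_pick_eq_0 by (auto simp: faces_equal_def)
qed

lemma bump_cell:
  assumes x: "x \<in> standard_simplex n"
  shows "case_prod (bump l \<tau> j) (cell \<sigma> x) = bump l \<tau> j \<sigma> x"
proof -
  define T where "T = {i. x i \<noteq> 0}"
  have T: "finite T" using supp_standard_simplex[OF x] finite_subset unfolding T_def by blast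
  have supp: "{i. pick T x i \<noteq> 0} = {..<card T}"
    using vertex_in[OF T] by (auto simp: pick_def T_def)
  have sub: "subsimplex (vertex T ` S) \<sigma> = subsimplex S (subsimplex T \<sigma>)"
    if "S \<subseteq> {..<card T}" "card S = Suc l" for S
  proof -
    have "S \<noteq> {}" using that(2) by auto
    then show ?thesis by (simp add: subsimplex_subsimplex[OF T that(1)])
  qed
  have "bij_betw ((`) (vertex T)) (faces_equal {..<card T} (subsimplex T \<sigma>) l \<tau>) (faces_equal T \<sigma> l \<tau>)"
    unfolding bij_betw_def
  proof
    show "inj_on ((`) (vertex T)) (faces_equal {..<card T} (subsimplex T \<sigma>) l \<tau>)"
      by (rule inj_on_subset[OF inj_on_image_Pow[OF vertex_inj[OF T]]]) (auto simp: faces_equal_def)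
    show "(`) (vertex T) ` faces_equal {..<card T} (subsimplex T \<sigma>) l \<tau> = faces_equal T \<sigma> l \<tau>"
    proof (intro equalityI subsetI)
      fix S assume "S \<in> (`) (vertex T) ` faces_equal {..<card T} (subsimplex T \<sigma>) l \<tau>"
      then obtain R where R: "S = vertex T ` R" "R \<subseteq> {..<card T}" "card R = Suc l"
          "subsimplex R (subsimplex T \<sigma>) = \<tau>"
        by (auto simp: faces_equal_def)
      then show "S \<in> faces_equal T \<sigma> l \<tau>"
        using vertex_image_subset[OF T R(2)] sub[OF R(2,3)] card_vertex_image[OF T R(2)]
        by (simp add: faces_equal_def)
    next
      fix S assume S: "S \<in> faces_equal T \<sigma> l \<tau>"
      then have "S \<subseteq> vertex T ` {..<card T}"
        using vertex_bij_betw[OF T] by (auto simp: bij_betw_def faces_equal_def)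
      then obtain R where R: "R \<subseteq> {..<card T}" "S = vertex T ` R" by (meson subset_imageE)
      then have "R \<in> faces_equal {..<card T} (subsimplex T \<sigma>) l \<tau>"
        using S sub[OF R(1)] card_vertex_image[OF T R(1)] by (simp add: faces_equal_def)
      with R show "S \<in> (`) (vertex T) ` faces_equal {..<card T} (subsimplex T \<sigma>) l \<tau>" by blast
    qed
  qed
  then have "bump l \<tau> j \<sigma> x = (\<Sum>S\<in>faces_equal {..<card T} (subsimplex T \<sigma>) l \<tau>.
      (\<Prod>i\<le>l. pick (vertex T ` S) x i) * pick (vertex T ` S) x j)"
    unfolding bump_def T_def[symmetric] by (rule sum.reindex_bij_betw[symmetric])
  also have "\<dots> = bump l \<tau> j (subsimplex T \<sigma>) (pick T x)"
    unfolding bump_def supp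
    by (rule sum.cong) (auto simp: faces_equal_def pick_pick[OF T])
  finally show ?thesis by (simp add: cell_def T_def)
qed

lemma continuous_map_pick_component:
  "continuous_map (simplex_space n) euclideanreal (\<lambda>x. pick S x i)"
proof -
  have "continuous_map (powertop_real UNIV) euclideanreal ((\<lambda>y. y i) \<circ> pick S)"
    by (intro continuous_map_compose[OF continuous_map_pick] continuous_map_product_projection) simp
  then show ?thesis by (simp add: comp_def continuous_map_from_subtopology)
qed

lemma continuous_map_bump:
  "continuous_map (skeleton m X) euclideanreal (case_prod (bump l \<tau> j))"
proof (rule continuous_map_from_skeleton)
  fix n \<sigma> assume "n \<le> m" "singular_simplex n X \<sigma>"
  have fin: "finite (faces_equal {..n} \<sigma> l \<tau>)"
    by (rule finite_subset[of _ "Pow {..n}"]) (auto simp: faces_equal_def)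
  have "continuous_map (simplex_space n) euclideanreal
      (\<lambda>x. \<Sum>S\<in>faces_equal {..n} \<sigma> l \<tau>. (\<Prod>i\<le>l. pick S x i) * pick S x j)"
    by (intro continuous_map_sum continuous_map_real_mult continuous_map_prod
        continuous_map_pick_component fin) auto
  then show "continuous_map (simplex_space n) euclideanreal (case_prod (bump l \<tau> j) \<circ> cell \<sigma>)"
    by (rule continuous_map_eq) (simp add: bump_cell bump_on_simplex)
qed

lemma bump_self:
  assumes y: "y \<in> open_simplex l" and \<tau>: "\<tau> \<in> extensional (standard_simplex l)"
  shows "bump l \<tau> j \<tau> y = (\<Prod>i\<le>l. y i) * y j"
proof -
  have y': "y \<in> standard_simplex l" and supp: "{i. y i \<noteq> 0} = {..l}"
    using y by (auto simp: open_simplex_def)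
  have full: "subsimplex {..l} \<tau> = \<tau>" "pick {..l} y = y"
    using cell_interior[OF y \<tau>] supp by (auto simp: cell_def)
  have "faces_equal {..l} \<tau> l \<tau> = {{..l}}"
    using full by (auto simp: faces_equal_def) (metis atMost_iff card_atMost card_subset_eq finite_atMost)
  then show ?thesis unfolding bump_def supp by (simp add: full)
qed

lemma bump_eq_0:
  assumes y: "y \<in> open_simplex n" and \<sigma>: "\<sigma> \<in> extensional (standard_simplex n)"
    and "n \<le> l" "n = l \<Longrightarrow> \<sigma> \<noteq> \<tau>"
  shows "bump l \<tau> j \<sigma> y = 0"
proof -
  have supp: "{i. y i \<noteq> 0} = {..n}" using y by (auto simp: open_simplex_def)
  have full: "subsimplex {..n} \<sigma> = \<sigma>"
    using cell_interior[OF y \<sigma>] supp by (auto simp: cell_def)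
  have "S = {..n} \<and> n = l" if "S \<subseteq> {..n}" "card S = Suc l" for S
    using that card_mono[OF finite_atMost that(1)] card_subset_eq[OF finite_atMost that(1)] assms(3)
    by auto
  then have "\<tau> = \<sigma> \<and> n = l" if "S \<in> faces_equal {..n} \<sigma> l \<tau>" for S
    using that full unfolding faces_equal_def by (metis (mono_tags, lifting) mem_Collect_eq)
  then have "faces_equal {..n} \<sigma> l \<tau> = {}"
    using assms(4) by auto
  then show ?thesis unfolding bump_def supp by simp
qed

lemma open_simplex_pos: "y \<in> open_simplex n \<Longrightarrow> i \<le> n \<Longrightarrow> y i > 0"
  by (force simp: open_simplex_def standard_simplex_def less_le)

text \<open>
  The functions for \<open>\<tau>\<close> vanish on every other open cell of at most the dimension of \<open>\<tau>\<close>, while at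
  \<open>(\<tau>, y)\<close> they take the positive values \<open>(\<Prod>i. y i) * y j\<close>. So they separate distinct open cells. The
  values for all \<open>j\<close> add up to \<open>\<Prod>i. y i\<close>, and so they determine \<open>y\<close>.
\<close>

lemma bump_separates:
  assumes P: "P \<in> skeleton_points m X" and Q: "Q \<in> skeleton_points m X" and "P \<noteq> Q"
  obtains l \<tau> j where "case_prod (bump l \<tau> j) P \<noteq> case_prod (bump l \<tau> j) Q"
proof -
  have *: "\<exists>l \<tau> j. bump l \<tau> j \<tau>\<^sub>1 y\<^sub>1 \<noteq> bump l \<tau> j \<tau>\<^sub>2 y\<^sub>2"
    if y1: "y\<^sub>1 \<in> open_simplex n\<^sub>1" and y2: "y\<^sub>2 \<in> open_simplex n\<^sub>2"
      and t1: "\<tau>\<^sub>1 \<in> extensional (standard_simplex n\<^sub>1)"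
      and t2: "\<tau>\<^sub>2 \<in> extensional (standard_simplex n\<^sub>2)"
      and le: "n\<^sub>2 \<le> n\<^sub>1" and ne: "(\<tau>\<^sub>1, y\<^sub>1) \<noteq> (\<tau>\<^sub>2, y\<^sub>2)"
    for n\<^sub>1 n\<^sub>2 y\<^sub>1 y\<^sub>2 and \<tau>\<^sub>1 \<tau>\<^sub>2 :: "(nat \<Rightarrow> real) \<Rightarrow> 'a"
  proof (cases "n\<^sub>1 = n\<^sub>2 \<and> \<tau>\<^sub>1 = \<tau>\<^sub>2")
    case False
    then have "bump n\<^sub>1 \<tau>\<^sub>1 0 \<tau>\<^sub>2 y\<^sub>2 = 0" by (intro bump_eq_0[OF y2 t2 le]) auto
    moreover have "bump n\<^sub>1 \<tau>\<^sub>1 0 \<tau>\<^sub>1 y\<^sub>1 > 0"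
      unfolding bump_self[OF y1 t1] by (intro mult_pos_pos prod_pos open_simplex_pos[OF y1]) auto
    ultimately show ?thesis by (metis less_irrefl)
  next
    case True
    show ?thesis
    proof (rule ccontr)
      assume "\<not> ?thesis"
      then have eq: "(\<Prod>i\<le>n\<^sub>1. y\<^sub>1 i) * y\<^sub>1 j = (\<Prod>i\<le>n\<^sub>1. y\<^sub>2 i) * y\<^sub>2 j" for j
        using True bump_self[OF y1 t1, of j] bump_self[OF y2 t2, of j] by metis
      have "(\<Prod>i\<le>n\<^sub>1. y\<^sub>1 i) * (\<Sum>j\<le>n\<^sub>1. y\<^sub>1 j) = (\<Prod>i\<le>n\<^sub>1. y\<^sub>2 i) * (\<Sum>j\<le>n\<^sub>1. y\<^sub>2 j)"
        unfolding sum_distrib_left using eq by simp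
      then have "(\<Prod>i\<le>n\<^sub>1. y\<^sub>1 i) = (\<Prod>i\<le>n\<^sub>1. y\<^sub>2 i)"
        using y1 y2 True by (simp add: open_simplex_def standard_simplex_def)
      moreover have "(\<Prod>i\<le>n\<^sub>1. y\<^sub>1 i) > 0"
        by (intro prod_pos open_simplex_pos[OF y1]) auto
      ultimately have "y\<^sub>1 j = y\<^sub>2 j" for j
        using eq[of j] by (metis less_irrefl mult_cancel_left)
      with ne True show False by auto
    qed
  qed
  obtain \<tau>\<^sub>1 y\<^sub>1 n\<^sub>1 where P': "P = (\<tau>\<^sub>1, y\<^sub>1)" "y\<^sub>1 \<in> open_simplex n\<^sub>1" "\<tau>\<^sub>1 \<in> extensional (standard_simplex n\<^sub>1)"
    using P by (auto simp: skeleton_points_def singular_simplex_def)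
  obtain \<tau>\<^sub>2 y\<^sub>2 n\<^sub>2 where Q': "Q = (\<tau>\<^sub>2, y\<^sub>2)" "y\<^sub>2 \<in> open_simplex n\<^sub>2" "\<tau>\<^sub>2 \<in> extensional (standard_simplex n\<^sub>2)"
    using Q by (auto simp: skeleton_points_def singular_simplex_def)
  have "\<exists>l \<tau> j. bump l \<tau> j \<tau>\<^sub>1 y\<^sub>1 \<noteq> bump l \<tau> j \<tau>\<^sub>2 y\<^sub>2"
  proof (cases "n\<^sub>2 \<le> n\<^sub>1")
    case True
    then show ?thesis using *[OF P'(2) Q'(2) P'(3) Q'(3)] \<open>P \<noteq> Q\<close> P'(1) Q'(1) by blast
  next
    case False
    then show ?thesis using *[OF Q'(2) P'(2) Q'(3) P'(3)] \<open>P \<noteq> Q\<close> P'(1) Q'(1) by force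
  qed
  then show thesis using that P'(1) Q'(1) by auto
qed

lemma Hausdorff_space_skeleton: "Hausdorff_space (skeleton m X)"
  unfolding Hausdorff_space_def
proof (intro allI impI, elim conjE)
  fix P Q assume "P \<in> topspace (skeleton m X)" "Q \<in> topspace (skeleton m X)" "P \<noteq> Q"
  then obtain l \<tau> j where ne: "case_prod (bump l \<tau> j) P \<noteq> case_prod (bump l \<tau> j) Q"
    using bump_separates by (metis topspace_skeleton)
  let ?f = "case_prod (bump l \<tau> j)"
  obtain U V where UV: "open U" "open V" "?f P \<in> U" "?f Q \<in> V" "U \<inter> V = {}"
    using hausdorff[OF ne] by blast
  have pre: "openin (skeleton m X) {x \<in> topspace (skeleton m X). ?f x \<in> W}" if "open W" for W
    using openin_continuous_map_preimage[OF continuous_map_bump] that by simp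
  show "\<exists>U V. openin (skeleton m X) U \<and> openin (skeleton m X) V \<and> P \<in> U \<and> Q \<in> V \<and> disjnt U V"
    apply (rule exI[of _ "{x \<in> topspace (skeleton m X). ?f x \<in> U}"])
    apply (rule exI[of _ "{x \<in> topspace (skeleton m X). ?f x \<in> V}"])
    using UV pre \<open>P \<in> _\<close> \<open>Q \<in> _\<close> by (auto simp: disjnt_def)
qed

section \<open>Discs and simplices\<close>

text \<open>
  The disc and the simplex are unit balls for two gauges, the Euclidean norm and the gauge of the
  simplex with respect to its barycentre. Rescaling every ray is a homeomorphism from one unit ball to the
  other. Where \<open>M x = 0\<close>, that is at the origin, the division by zero gives the origin, as it should.
\<close>

definition radial :: "((nat \<Rightarrow> real) \<Rightarrow> real) \<Rightarrow> ((nat \<Rightarrow> real) \<Rightarrow> real) \<Rightarrow> (nat \<Rightarrow> real) \<Rightarrow> nat \<Rightarrow> real" where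
  "radial N M x = (\<lambda>i. N x / M x * x i)"

text \<open>
  The bound on the coordinates gives both definiteness and the estimate that makes \<open>radial\<close> continuous at the
  origin.
\<close>

definition gauge_on :: "(nat \<Rightarrow> real) set \<Rightarrow> ((nat \<Rightarrow> real) \<Rightarrow> real) \<Rightarrow> bool" where
  "gauge_on V N \<longleftrightarrow> continuous_on V N \<and> (\<forall>x\<in>V. \<forall>i. \<bar>x i\<bar> \<le> N x) \<and>
     (\<forall>x\<in>V. \<forall>c\<ge>0. N (\<lambda>i. c * x i) = c * N x)"

lemma gauge_on_nonneg: "gauge_on V N \<Longrightarrow> x \<in> V \<Longrightarrow> N x \<ge> 0"
  unfolding gauge_on_def by (meson abs_ge_zero order_trans)

lemma gauge_on_scale: "gauge_on V N \<Longrightarrow> x \<in> V \<Longrightarrow> c \<ge> 0 \<Longrightarrow> N (\<lambda>i. c * x i) = c * N x"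
  by (simp add: gauge_on_def)

lemma continuous_on_coordinate:
  "continuous_on V (\<lambda>x :: nat \<Rightarrow> real. x i)"
  by (rule continuous_on_subset[OF continuous_on_product_coordinates]) simp

lemma gauge_on_eq_0: "gauge_on V N \<Longrightarrow> x \<in> V \<Longrightarrow> N x = 0 \<longleftrightarrow> x = (\<lambda>i. 0)"
proof
  assume *: "gauge_on V N" "x \<in> V"
  show "x = (\<lambda>i. 0)" if "N x = 0"
  proof
    fix i
    have "\<bar>x i\<bar> \<le> N x" using * by (simp add: gauge_on_def)
    then show "x i = 0" using that by simp
  qed
  show "N x = 0" if "x = (\<lambda>i. 0)"
    using gauge_on_scale[OF *, of 0] that by simp
qed

lemma gauge_radial:
  assumes "gauge_on V N" "gauge_on V M" "x \<in> V"
  shows "M (radial N M x) = N x"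
proof -
  have "M (radial N M x) = N x / M x * M x"
    unfolding radial_def
    by (intro gauge_on_scale[OF assms(2,3)] divide_nonneg_nonneg gauge_on_nonneg[OF assms(1,3)]
        gauge_on_nonneg[OF assms(2,3)])
  also have "\<dots> = N x"
    using gauge_on_eq_0[OF assms(1,3)] gauge_on_eq_0[OF assms(2,3)] by auto
  finally show ?thesis .
qed

lemma radial_radial:
  assumes N: "gauge_on V N" and M: "gauge_on V M" and x: "x \<in> V"
  shows "radial M N (radial N M x) = x"
proof (cases "x = (\<lambda>i. 0)")
  case False
  then have "M x \<noteq> 0" "N x \<noteq> 0" using gauge_on_eq_0[OF M x] gauge_on_eq_0[OF N x] by auto
  moreover have "N (radial N M x) = N x / M x * N x"
    unfolding radial_def
    by (intro gauge_on_scale[OF N x] divide_nonneg_nonneg gauge_on_nonneg[OF N x] gauge_on_nonneg[OF M x])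
  ultimately show ?thesis
    unfolding radial_def[of M N] gauge_radial[OF assms] by (simp add: radial_def fun_eq_iff)
qed (simp add: radial_def)

text \<open>
  Away from the origin this is continuity of a quotient. At the origin, \<open>\<bar>x i\<bar> \<le> M x\<close> bounds the
  coordinates of \<open>radial N M x\<close> by \<open>N x\<close>.
\<close>

lemma continuous_on_radial:
  assumes N: "gauge_on V N" and M: "gauge_on V M"
  shows "continuous_on V (radial N M)"
proof (rule continuous_on_coordinatewise_then_product)
  fix i
  have cN: "continuous_on V N" and cM: "continuous_on V M" using N M by (auto simp: gauge_on_def)
  have proj: "continuous_on V (\<lambda>x. x i)" by (rule continuous_on_coordinate)
  have "((\<lambda>x. radial N M x i) \<longlongrightarrow> radial N M a i) (at a within V)" if a: "a \<in> V" for a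
  proof (cases "a = (\<lambda>i. 0)")
    case False
    then have "M a \<noteq> 0" using gauge_on_eq_0[OF M a] by simp
    then show ?thesis
      using cN cM proj a unfolding radial_def continuous_on_def by (intro tendsto_intros) auto
  next
    case True
    have "\<bar>radial N M x i\<bar> \<le> N x" if "x \<in> V" for x
    proof (cases "M x = 0")
      case False
      then have "M x > 0" using gauge_on_nonneg[OF M that] by simp
      have "\<bar>radial N M x i\<bar> = N x * (\<bar>x i\<bar> / M x)"
        using \<open>M x > 0\<close> gauge_on_nonneg[OF N that] by (simp add: radial_def abs_mult)
      also have "\<dots> \<le> N x * 1"
        using M that \<open>M x > 0\<close> gauge_on_nonneg[OF N that]
        by (intro mult_left_mono) (auto simp: gauge_on_def)
      finally show ?thesis by simp
    qed (use gauge_on_nonneg[OF N that] in \<open>simp add: radial_def\<close>)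
    then have le: "\<forall>\<^sub>F x in at a within V. \<bar>radial N M x i\<bar> \<le> N x"
      by (simp add: eventually_at_filter)
    have lim: "(N \<longlongrightarrow> 0) (at a within V)"
      using cN a True gauge_on_eq_0[OF N a] by (auto simp: continuous_on_def)
    have "((\<lambda>x. \<bar>radial N M x i\<bar>) \<longlongrightarrow> 0) (at a within V)"
      by (rule tendsto_sandwich[OF _ le tendsto_const lim]) simp
    then have "((\<lambda>x. radial N M x i) \<longlongrightarrow> 0) (at a within V)"
      by (rule tendsto_rabs_zero_cancel)
    then show ?thesis using True by (simp add: radial_def)
  qed
  then show "continuous_on V (\<lambda>x. radial N M x i)" by (auto simp: continuous_on_def)
qed

lemma gauge_norm:
  "gauge_on {x. \<forall>i\<ge>n. x i = 0} (\<lambda>x. sqrt (\<Sum>i<n. (x i)\<^sup>2))"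
  unfolding gauge_on_def
proof (intro conjI ballI allI impI)
  show "continuous_on {x. \<forall>i\<ge>n. x i = 0} (\<lambda>x. sqrt (\<Sum>i<n. (x i)\<^sup>2))"
    by (rule continuous_on_real_sqrt, rule continuous_on_sum, rule continuous_on_power, rule continuous_on_coordinate)
  fix x :: "nat \<Rightarrow> real" and i assume "x \<in> {x. \<forall>i\<ge>n. x i = 0}"
  then have "(x i)\<^sup>2 \<le> (\<Sum>i<n. (x i)\<^sup>2)"
    using member_le_sum[of i "{..<n}" "\<lambda>i. (x i)\<^sup>2"] by (cases "i < n") (simp_all add: sum_nonneg)
  then show "\<bar>x i\<bar> \<le> sqrt (\<Sum>i<n. (x i)\<^sup>2)"
    using real_sqrt_le_mono[of "(x i)\<^sup>2"] by simp
next
  fix x :: "nat \<Rightarrow> real" and c :: real assume "c \<ge> 0"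
  then show "sqrt (\<Sum>i<n. (c * x i)\<^sup>2) = c * sqrt (\<Sum>i<n. (x i)\<^sup>2)"
    by (simp add: power_mult_distrib real_sqrt_mult flip: sum_distrib_left)
qed

text \<open>
  The first \<open>n\<close> barycentric coordinates, relative to the barycentre, serve as coordinates of the simplex; the
  last one is then minus their sum. The point \<open>x\<close> lies in the simplex if and only if all \<open>n + 1\<close>
  relative coordinates are at least \<open>- 1 / (n + 1)\<close>.
\<close>

definition simplex_gauge :: "nat \<Rightarrow> (nat \<Rightarrow> real) \<Rightarrow> real" where
  "simplex_gauge n x = Max ((\<lambda>i. real (n + 1) * (if i < n then - x i else (\<Sum>j<n. x j))) ` {..n})"

lemma simplex_gauge_le_iff:
  "simplex_gauge n x \<le> c \<longleftrightarrow> (\<forall>i<n. - (real (n + 1) * x i) \<le> c) \<and> real (n + 1) * (\<Sum>j<n. x j) \<le> c"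
  unfolding simplex_gauge_def by (subst Max_le_iff) (auto simp: le_less)

lemma simplex_gauge_less_iff:
  "simplex_gauge n x < c \<longleftrightarrow> (\<forall>i<n. - (real (n + 1) * x i) < c) \<and> real (n + 1) * (\<Sum>j<n. x j) < c"
  unfolding simplex_gauge_def by (subst Max_less_iff) (auto simp: le_less)

lemma continuous_on_Max:
  fixes f :: "nat \<Rightarrow> 'a::topological_space \<Rightarrow> real"
  assumes "\<And>i. continuous_on A (f i)"
  shows "continuous_on A (\<lambda>x. Max ((\<lambda>i. f i x) ` {..n}))"
proof (induction n)
  case (Suc n)
  have "Max ((\<lambda>i. f i x) ` {..Suc n}) = max (f (Suc n) x) (Max ((\<lambda>i. f i x) ` {..n}))" for x
    by (simp add: atMost_Suc)
  then show ?case using Suc assms by (simp add: continuous_on_max)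
qed (use assms in simp)

lemma gauge_simplex_gauge: "gauge_on {x. \<forall>i\<ge>n. x i = 0} (simplex_gauge n)"
  unfolding gauge_on_def
proof (intro conjI ballI allI impI)
  have "continuous_on V (\<lambda>x. real (n + 1) * (if i < n then - x i else (\<Sum>j<n. x j)))" for i V
    by (cases "i < n") (auto intro!: continuous_on_mult continuous_on_minus continuous_on_sum
        continuous_on_const continuous_on_coordinate)
  then show "continuous_on {x. \<forall>i\<ge>n. x i = 0} (simplex_gauge n)"
    unfolding simplex_gauge_def by (rule continuous_on_Max)
  fix x :: "nat \<Rightarrow> real" and i assume x: "x \<in> {x. \<forall>i\<ge>n. x i = 0}"
  let ?g = "simplex_gauge n x"
  define q where "q = ?g / real (n + 1)"
  have "?g = real (n + 1) * q" by (simp add: q_def)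
  then have g: "?g = real n * q + q" by (simp add: algebra_simps)
  have low: "- x j \<le> q" if "j < n" for j
  proof -
    have "- (real (n + 1) * x j) \<le> ?g"
      using that iffD1[OF simplex_gauge_le_iff order_refl] by blast
    then show ?thesis unfolding q_def by (simp add: field_simps)
  qed
  have up: "(\<Sum>j<n. x j) \<le> q"
  proof -
    have "real (n + 1) * (\<Sum>j<n. x j) \<le> ?g"
      using iffD1[OF simplex_gauge_le_iff order_refl] by blast
    then show ?thesis unfolding q_def by (simp add: field_simps)
  qed
  \<comment> \<open>The relative coordinates sum to \<open>0\<close>, so not all of them are positive and the gauge is nonnegative.\<close>
  have "(\<Sum>j<n. - x j) \<le> (\<Sum>j<n. q)" by (intro sum_mono low) auto
  then have pos: "?g \<ge> 0" using up g by (simp add: sum_negf)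
  then have q: "q \<ge> 0" by (simp add: q_def)
  show "\<bar>x i\<bar> \<le> ?g"
  proof (cases "i < n")
    case True
    have "(\<Sum>j\<in>{..<n} - {i}. - x j) \<le> (\<Sum>j\<in>{..<n} - {i}. q)" by (intro sum_mono low) auto
    also have "\<dots> \<le> (\<Sum>j<n. q)" using q by (intro sum_mono2) auto
    finally have "(\<Sum>j\<in>{..<n} - {i}. - x j) \<le> real n * q" by simp
    moreover have "(\<Sum>j<n. x j) = x i + (\<Sum>j\<in>{..<n} - {i}. x j)"
      using True by (intro sum.remove) auto
    ultimately have "x i \<le> ?g" using up g by (simp add: sum_negf)
    moreover have "q \<le> ?g" using q g by simp
    ultimately show ?thesis using low[OF True] by linarith
  qed (use x pos in auto)
next
  fix x :: "nat \<Rightarrow> real" and c :: real assume c: "c \<ge> 0"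
  let ?F = "(\<lambda>i. real (n + 1) * (if i < n then - x i else (\<Sum>j<n. x j))) ` {..n}"
  have "c * Max ?F = Max ((*) c ` ?F)"
    using c by (intro mono_Max_commute) (auto intro!: monoI mult_left_mono)
  also have "(*) c ` ?F = (\<lambda>i. real (n + 1) * (if i < n then - (c * x i) else (\<Sum>j<n. c * x j))) ` {..n}"
    unfolding image_image by (intro image_cong) (auto simp: sum_distrib_left)
  finally show "simplex_gauge n (\<lambda>i. c * x i) = c * simplex_gauge n x"
    by (simp add: simplex_gauge_def)
qed

definition from_barycentre :: "nat \<Rightarrow> (nat \<Rightarrow> real) \<Rightarrow> nat \<Rightarrow> real" where
  "from_barycentre n v = (\<lambda>i. if i < n then 1 / real (n + 1) + v i
     else if i = n then 1 / real (n + 1) - (\<Sum>j<n. v j) else 0)"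

definition to_barycentre :: "nat \<Rightarrow> (nat \<Rightarrow> real) \<Rightarrow> nat \<Rightarrow> real" where
  "to_barycentre n x = (\<lambda>i. if i < n then x i - 1 / real (n + 1) else 0)"

lemma sum_from_barycentre: "(\<Sum>i\<le>n. from_barycentre n v i) = 1"
proof -
  have "(\<Sum>i\<le>n. from_barycentre n v i) = (\<Sum>i<n. from_barycentre n v i) + from_barycentre n v n"
    by (simp flip: lessThan_Suc_atMost)
  also have "\<dots> = (\<Sum>i<n. 1 / real (n + 1) + v i) + (1 / real (n + 1) - (\<Sum>j<n. v j))"
    unfolding from_barycentre_def by (intro arg_cong2[of _ _ _ _ "(+)"] sum.cong) auto
  also have "\<dots> = real n * (1 / real (n + 1)) + 1 / real (n + 1)" by (simp add: sum.distrib)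
  also have "\<dots> = 1" by (simp add: field_simps)
  finally show ?thesis .
qed

lemma in_standard_simplexI:
  assumes "\<And>i. x i \<ge> 0" "\<And>i. i > n \<Longrightarrow> x i = 0" "(\<Sum>i\<le>n. x i) = 1"
  shows "x \<in> standard_simplex n"
proof -
  have "x i \<le> 1" for i
    using assms member_le_sum[of i "{..n}" x] by (cases "i \<le> n") auto
  then show ?thesis using assms by (auto simp: standard_simplex_def)
qed

lemma from_barycentre_in_simplex:
  assumes "simplex_gauge n v \<le> 1" shows "from_barycentre n v \<in> standard_simplex n"
  using assms sum_from_barycentre unfolding simplex_gauge_le_iff
  by (intro in_standard_simplexI) (auto simp: from_barycentre_def field_simps)

lemma from_barycentre_in_open_simplex:
  assumes "simplex_gauge n v \<le> 1"
  shows "from_barycentre n v \<in> open_simplex n \<longleftrightarrow> simplex_gauge n v < 1"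
proof -
  have "from_barycentre n v \<in> open_simplex n \<longleftrightarrow> (\<forall>i\<le>n. from_barycentre n v i > 0)"
    using from_barycentre_in_simplex[OF assms] supp_standard_simplex[OF from_barycentre_in_simplex[OF assms]]
    by (force simp: open_simplex_def standard_simplex_def less_le)
  also have "\<dots> \<longleftrightarrow> simplex_gauge n v < 1"
    unfolding simplex_gauge_less_iff by (auto simp: from_barycentre_def field_simps le_less)
  finally show ?thesis .
qed

lemma to_from_barycentre: "\<forall>i\<ge>n. v i = 0 \<Longrightarrow> to_barycentre n (from_barycentre n v) = v"
  by (auto simp: to_barycentre_def from_barycentre_def)

lemma sum_to_barycentre: "(\<Sum>j<n. to_barycentre n x j) = (\<Sum>j<n. x j) - (1 - 1 / real (n + 1))"
proof -
  have "(\<Sum>j<n. to_barycentre n x j) = (\<Sum>j<n. x j) - real n / real (n + 1)"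
    by (simp add: to_barycentre_def sum_subtractf)
  also have "real n / real (n + 1) = 1 - 1 / real (n + 1)" by (simp add: field_simps)
  finally show ?thesis .
qed

lemma from_to_barycentre:
  assumes "x \<in> standard_simplex n" shows "from_barycentre n (to_barycentre n x) = x"
proof
  fix i
  have "(\<Sum>j<n. x j) + x n = 1" "i > n \<Longrightarrow> x i = 0"
    using assms by (simp_all add: standard_simplex_def flip: lessThan_Suc_atMost)
  then show "from_barycentre n (to_barycentre n x) i = x i"
    unfolding from_barycentre_def sum_to_barycentre by (auto simp: to_barycentre_def)
qed

lemma gauge_to_barycentre:
  assumes "x \<in> standard_simplex n" shows "simplex_gauge n (to_barycentre n x) \<le> 1"
  unfolding simplex_gauge_le_iff sum_to_barycentre
proof (intro conjI allI impI)
  have "(\<Sum>j<n. x j) + x n = 1" and pos: "x i \<ge> 0" for i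
    using assms by (simp_all add: standard_simplex_def flip: lessThan_Suc_atMost)
  then have le: "(\<Sum>j<n. x j) - (1 - 1 / real (n + 1)) \<le> 1 / real (n + 1)" using pos[of n] by linarith
  have scale: "real (n + 1) * a \<le> 1" if "a \<le> 1 / real (n + 1)" for a
  proof -
    have "real (n + 1) * a \<le> real (n + 1) * (1 / real (n + 1))" by (rule mult_left_mono[OF that]) simp
    then show ?thesis by simp
  qed
  show "real (n + 1) * ((\<Sum>j<n. x j) - (1 - 1 / real (n + 1))) \<le> 1" by (rule scale[OF le])
  fix i assume "i < n"
  then have "- to_barycentre n x i \<le> 1 / real (n + 1)" using pos[of i] by (simp add: to_barycentre_def)
  from scale[OF this] show "- (real (n + 1) * to_barycentre n x i) \<le> 1" by (simp only: mult_minus_right)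
qed

lemma disc_eq: "disc n = top_of_set {x. (\<forall>i\<ge>n. x i = 0) \<and> (\<Sum>i<n. (x i)\<^sup>2) \<le> 1}"
  by (simp add: disc_def Euclidean_space_def subtopology_subtopology euclidean_product_topology Collect_conj_eq)

lemma simplex_space_eq: "simplex_space n = top_of_set (standard_simplex n)"
  by (simp add: euclidean_product_topology)

definition disc_to_simplex :: "nat \<Rightarrow> (nat \<Rightarrow> real) \<Rightarrow> nat \<Rightarrow> real" where
  "disc_to_simplex n = from_barycentre n \<circ> radial (\<lambda>x. sqrt (\<Sum>i<n. (x i)\<^sup>2)) (simplex_gauge n)"

lemma homeomorphic_map_disc_to_simplex: "homeomorphic_map (disc n) (simplex_space n) (disc_to_simplex n)"
proof -
  let ?E = "{x. \<forall>i\<ge>n. x i = 0} :: (nat \<Rightarrow> real) set"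
  let ?N = "\<lambda>x :: nat \<Rightarrow> real. sqrt (\<Sum>i<n. (x i)\<^sup>2)"
  let ?G = "simplex_gauge n"
  let ?D = "{x. (\<forall>i\<ge>n. x i = 0) \<and> (\<Sum>i<n. (x i)\<^sup>2) \<le> 1} :: (nat \<Rightarrow> real) set"
  have [simp]: "radial M M' x \<in> ?E" if "x \<in> ?E" for M M' x
    using that by (simp add: radial_def)
  have to: "to_barycentre n x \<in> ?E" for x by (simp add: to_barycentre_def)
  have G_radial: "?G (radial ?N ?G x) = ?N x" if "x \<in> ?E" for x
    by (rule gauge_radial[OF gauge_norm gauge_simplex_gauge that])
  have N_radial: "?N (radial ?G ?N x) = ?G x" if "x \<in> ?E" for x
    by (rule gauge_radial[OF gauge_simplex_gauge gauge_norm that])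
  have "continuous_on UNIV (\<lambda>v. from_barycentre n v i)" for i
    unfolding from_barycentre_def
    by (cases "i < n"; cases "i = n") (auto intro!: continuous_on_add continuous_on_diff continuous_on_sum
        continuous_on_const continuous_on_coordinate)
  then have from_cont: "continuous_on UNIV (from_barycentre n)"
    by (rule continuous_on_coordinatewise_then_product)
  have "continuous_on UNIV (\<lambda>v. to_barycentre n v i)" for i
    unfolding to_barycentre_def
    by (cases "i < n") (auto intro!: continuous_on_add continuous_on_diff continuous_on_sum
        continuous_on_const continuous_on_coordinate)
  then have to_cont: "continuous_on UNIV (to_barycentre n)"
    by (rule continuous_on_coordinatewise_then_product)
  have "continuous_on ?D (disc_to_simplex n)"
    unfolding disc_to_simplex_def
    by (intro continuous_on_compose continuous_on_subset[OF from_cont]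
        continuous_on_subset[OF continuous_on_radial[OF gauge_norm gauge_simplex_gauge]]) auto
  moreover have "disc_to_simplex n x \<in> standard_simplex n" if "x \<in> ?D" for x
    using that G_radial[of x] by (auto simp: disc_to_simplex_def intro!: from_barycentre_in_simplex)
  moreover have "continuous_on (standard_simplex n) (radial ?G ?N \<circ> to_barycentre n)"
    using to
    by (intro continuous_on_compose continuous_on_subset[OF to_cont]
        continuous_on_subset[OF continuous_on_radial[OF gauge_simplex_gauge gauge_norm]]) auto
  moreover have "radial ?G ?N (to_barycentre n x) \<in> ?D" if "x \<in> standard_simplex n" for x
  proof -
    have "?N (radial ?G ?N (to_barycentre n x)) \<le> 1"
      using N_radial[OF to] gauge_to_barycentre[OF that] by simp
    then show ?thesis using to[of x] by (simp add: radial_def)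
  qed
  moreover have "radial ?G ?N (to_barycentre n (disc_to_simplex n x)) = x" if "x \<in> ?D" for x
  proof -
    have "to_barycentre n (disc_to_simplex n x) = radial ?N ?G x"
      unfolding disc_to_simplex_def comp_def using that by (intro to_from_barycentre) (simp add: radial_def)
    then show ?thesis using radial_radial[OF gauge_norm gauge_simplex_gauge, of x] that by simp
  qed
  moreover have "disc_to_simplex n (radial ?G ?N (to_barycentre n x)) = x" if "x \<in> standard_simplex n" for x
    using radial_radial[OF gauge_simplex_gauge gauge_norm to, of x] from_to_barycentre[OF that]
    by (simp add: disc_to_simplex_def)
  ultimately have "homeomorphic_maps (disc n) (simplex_space n) (disc_to_simplex n)
      (radial ?G ?N \<circ> to_barycentre n)"
    unfolding homeomorphic_maps_def disc_eq simplex_space_eq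
    by auto
  then show ?thesis by (rule homeomorphic_maps_imp_map)
qed

lemma disc_to_simplex_interior:
  assumes "x \<in> topspace (disc n)"
  shows "disc_to_simplex n x \<in> open_simplex n \<longleftrightarrow> x \<in> disc_interior n"
proof -
  have x: "\<forall>i\<ge>n. x i = 0" "(\<Sum>i<n. (x i)\<^sup>2) \<le> 1" using assms by (auto simp: disc_eq)
  then have "simplex_gauge n (radial (\<lambda>x. sqrt (\<Sum>i<n. (x i)\<^sup>2)) (simplex_gauge n) x) = sqrt (\<Sum>i<n. (x i)\<^sup>2)"
    by (intro gauge_radial[OF gauge_norm gauge_simplex_gauge]) auto
  then show ?thesis
    using x assms by (simp add: disc_to_simplex_def from_barycentre_in_open_simplex disc_interior_def)
qed

section \<open>The cell structure\<close>

definition skeleton_cells ::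
  "nat \<Rightarrow> 'a topology \<Rightarrow> (nat \<times> ((nat \<Rightarrow> real) \<Rightarrow> 'a cw_point)) set" where
  "(skeleton_cells m X) =
     {(n, cell \<sigma> \<circ> disc_to_simplex n) |n \<sigma>. n \<le> m \<and> singular_simplex n X \<sigma>}"

lemma skeleton_cellsI:
  "n \<le> m \<Longrightarrow> singular_simplex n X \<sigma> \<Longrightarrow> (n, cell \<sigma> \<circ> disc_to_simplex n) \<in> (skeleton_cells m X)"
  unfolding skeleton_cells_def by blast

lemma disc_to_simplex_in_simplex:
  "x \<in> topspace (disc n) \<Longrightarrow> disc_to_simplex n x \<in> standard_simplex n"
  using homeomorphic_imp_surjective_map[OF homeomorphic_map_disc_to_simplex] by fastforce

lemma disc_to_simplex_surj:
  assumes "y \<in> standard_simplex n"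
  obtains x where "x \<in> topspace (disc n)" "y = disc_to_simplex n x"
  using homeomorphic_imp_surjective_map[OF homeomorphic_map_disc_to_simplex[of n]] assms by auto

lemma disc_interior_subset: "disc_interior n \<subseteq> topspace (disc n)"
  by (auto simp: disc_interior_def)

lemma image_disc_interior: "disc_to_simplex n ` disc_interior n = open_simplex n"
proof (intro equalityI subsetI)
  fix y assume y: "y \<in> open_simplex n"
  then obtain x where "x \<in> topspace (disc n)" "y = disc_to_simplex n x"
    using disc_to_simplex_surj by (metis (no_types, lifting) mem_Collect_eq open_simplex_def)
  then show "y \<in> disc_to_simplex n ` disc_interior n"
    using y disc_to_simplex_interior by blast
qed (use disc_to_simplex_interior disc_interior_subset in blast)

lemma image_open_cell:
  assumes "singular_simplex n X \<sigma>"
  shows "(cell \<sigma> \<circ> disc_to_simplex n) ` disc_interior n = {\<sigma>} \<times> open_simplex n"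
proof -
  have "\<sigma> \<in> extensional (standard_simplex n)" using assms by (simp add: singular_simplex_def)
  then have "cell \<sigma> ` open_simplex n = {\<sigma>} \<times> open_simplex n"
    by (auto simp: cell_interior intro!: image_eqI)
  then show ?thesis by (simp only: image_comp[symmetric] image_disc_interior)
qed

lemma open_simplex_unique: "y \<in> open_simplex n \<Longrightarrow> y \<in> open_simplex l \<Longrightarrow> n = l"
  by (auto simp: open_simplex_def)

lemma cell_in_open_cell_iff:
  assumes x: "x \<in> standard_simplex n" and \<sigma>: "singular_simplex n X \<sigma>"
  shows "cell \<sigma> x \<in> {\<sigma>} \<times> open_simplex n \<longleftrightarrow> x \<in> open_simplex n"
proof
  let ?T = "{i. x i \<noteq> 0}"
  assume "cell \<sigma> x \<in> {\<sigma>} \<times> open_simplex n"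
  then have "n = card ?T - Suc 0"
    using open_simplex_unique[OF _ pick_support_in_open_simplex[OF x]] by (simp add: cell_def)
  moreover have "card ?T > 0"
    using supp_nonempty[OF x] finite_subset[OF supp_standard_simplex[OF x]] by (simp only: card_gt_0_iff) blast
  ultimately have "card ?T = card {..n}" by simp
  then have "?T = {..n}" using supp_standard_simplex[OF x] by (intro card_subset_eq) auto
  then show "x \<in> open_simplex n" using x by (simp add: open_simplex_def)
next
  assume "x \<in> open_simplex n"
  then show "cell \<sigma> x \<in> {\<sigma>} \<times> open_simplex n"
    using \<sigma> by (simp add: cell_interior singular_simplex_def)
qed

lemma continuous_map_characteristic:
  assumes "n \<le> m" "singular_simplex n X \<sigma>"
  shows "continuous_map (disc n) (skeleton m X) (cell \<sigma> \<circ> disc_to_simplex n)"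
  by (intro continuous_map_compose[OF homeomorphic_imp_continuous_map
        [OF homeomorphic_map_disc_to_simplex]] continuous_map_cell assms)

text \<open>
  A characteristic map is closed, being a continuous map from a compact space to a Hausdorff space. It stays
  closed on the interior of the disc, since this is the full preimage of the open cell.
\<close>

lemma embedding_map_characteristic:
  assumes n: "n \<le> m" and \<sigma>: "singular_simplex n X \<sigma>"
  shows "embedding_map (subtopology (disc n) (disc_interior n)) (skeleton m X) (cell \<sigma> \<circ> disc_to_simplex n)"
proof -
  let ?f = "cell \<sigma> \<circ> disc_to_simplex n"
  have "compact_space (simplex_space n)"
    by (simp add: compact_space_subtopology compactin_standard_simplex)
  then have "compact_space (disc n)"
    using homeomorphic_compact_space homeomorphic_map_disc_to_simplex homeomorphic_space by blast
  then have closed: "closed_map (disc n) (skeleton m X) ?f"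
    by (rule continuous_imp_closed_map[OF continuous_map_characteristic[OF assms] _ Hausdorff_space_skeleton])
  have "?f x \<in> {\<sigma>} \<times> open_simplex n \<longleftrightarrow> x \<in> disc_interior n" if "x \<in> topspace (disc n)" for x
    unfolding comp_apply cell_in_open_cell_iff[OF disc_to_simplex_in_simplex[OF that] \<sigma>]
    by (rule disc_to_simplex_interior[OF that])
  then have "{x \<in> topspace (disc n). ?f x \<in> {\<sigma>} \<times> open_simplex n} =
      {x \<in> topspace (disc n). x \<in> disc_interior n}"
    by (intro Collect_cong conj_cong refl)
  also have "\<dots> = disc_interior n" using disc_interior_subset by blast
  finally have "{x \<in> topspace (disc n). ?f x \<in> {\<sigma>} \<times> open_simplex n} = disc_interior n" .
  from closed_map_restriction[OF closed this]
  have closed': "closed_map (subtopology (disc n) (disc_interior n))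
      (subtopology (skeleton m X) ({\<sigma>} \<times> open_simplex n)) ?f" .
  have inj: "inj_on ?f (disc_interior n)"
  proof (rule inj_onI)
    fix x y assume xy: "x \<in> disc_interior n" "y \<in> disc_interior n" "?f x = ?f y"
    then have "disc_to_simplex n x \<in> open_simplex n" "disc_to_simplex n y \<in> open_simplex n"
      using image_disc_interior by blast+
    then have "disc_to_simplex n x = disc_to_simplex n y"
      using xy(3) \<sigma> by (simp add: cell_interior singular_simplex_def)
    then show "x = y"
      using homeomorphic_imp_injective_map[OF homeomorphic_map_disc_to_simplex[of n]] xy disc_interior_subset
      by (meson inj_onD subsetD)
  qed
  have top: "topspace (subtopology (disc n) (disc_interior n)) = disc_interior n"
    using disc_interior_subset by (simp add: Int_absorb1)
  have sub: "{\<sigma>} \<times> open_simplex n \<subseteq> topspace (skeleton m X)"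
    using assms by (auto simp: skeleton_points_def)
  show ?thesis
    unfolding embedding_map_def top image_open_cell[OF \<sigma>]
  proof (rule bijective_closed_imp_homeomorphic_map[OF _ closed'])
    show "continuous_map (subtopology (disc n) (disc_interior n))
        (subtopology (skeleton m X) ({\<sigma>} \<times> open_simplex n)) ?f"
    proof (rule continuous_map_into_subtopology)
      show "continuous_map (subtopology (disc n) (disc_interior n)) (skeleton m X) ?f"
        by (rule continuous_map_from_subtopology[OF continuous_map_characteristic[OF assms]])
      show "?f \<in> topspace (subtopology (disc n) (disc_interior n)) \<rightarrow> {\<sigma>} \<times> open_simplex n"
        unfolding top using image_open_cell[OF \<sigma>] by blast
    qed
    show "?f ` topspace (subtopology (disc n) (disc_interior n)) =
        topspace (subtopology (skeleton m X) ({\<sigma>} \<times> open_simplex n))"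
      unfolding top unfolding image_open_cell[OF \<sigma>] topspace_subtopology
      using sub by (rule Int_absorb1[symmetric])
    show "inj_on ?f (topspace (subtopology (disc n) (disc_interior n)))"
      unfolding top by (rule inj)
  qed
qed

lemma disjoint_open_cells: "disjoint_family_on (\<lambda>(n, \<Phi>). \<Phi> ` disc_interior n) (skeleton_cells m X)"
  unfolding disjoint_family_on_def
proof (intro ballI impI)
  fix c c' assume "c \<in> (skeleton_cells m X)" "c' \<in> (skeleton_cells m X)" and ne: "c \<noteq> c'"
  then obtain n \<sigma> n' \<sigma>' where c: "c = (n, cell \<sigma> \<circ> disc_to_simplex n)" "singular_simplex n X \<sigma>"
    and c': "c' = (n', cell \<sigma>' \<circ> disc_to_simplex n')" "singular_simplex n' X \<sigma>'"
    by (auto simp: skeleton_cells_def)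
  have "({\<sigma>} \<times> open_simplex n) \<inter> ({\<sigma>'} \<times> open_simplex n') = {}"
    using ne c(1) c'(1) open_simplex_unique by blast
  then show "(case c of (n, \<Phi>) \<Rightarrow> \<Phi> ` disc_interior n) \<inter> (case c' of (n, \<Phi>) \<Rightarrow> \<Phi> ` disc_interior n) = {}"
    unfolding c(1) c'(1) prod.case image_open_cell[OF c(2)] image_open_cell[OF c'(2)] .
qed

lemma Union_open_cells: "(\<Union>(n, \<Phi>)\<in>(skeleton_cells m X). \<Phi> ` disc_interior n) = topspace (skeleton m X)"
proof -
  have "(\<Union>(n, \<Phi>)\<in>(skeleton_cells m X). \<Phi> ` disc_interior n) =
      (\<Union>n\<in>{..m}. \<Union>\<sigma>\<in>{\<sigma>. singular_simplex n X \<sigma>}. (cell \<sigma> \<circ> disc_to_simplex n) ` disc_interior n)"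
    unfolding skeleton_cells_def by blast
  also have "\<dots> = (\<Union>n\<in>{..m}. \<Union>\<sigma>\<in>{\<sigma>. singular_simplex n X \<sigma>}. {\<sigma>} \<times> open_simplex n)"
    by (intro SUP_cong refl image_open_cell) blast
  also have "\<dots> = topspace (skeleton m X)" by (auto simp: skeleton_points_def)
  finally show ?thesis .
qed

text \<open>
  A boundary point of the simplex is carried by a proper face, and there are finitely many of these.
\<close>

lemma characteristic_boundary:
  assumes n: "n \<le> m" and \<sigma>: "singular_simplex n X \<sigma>"
  shows "\<exists>F\<subseteq>(skeleton_cells m X). finite F \<and> (\<forall>(l, \<Psi>)\<in>F. l < n) \<and>
      (cell \<sigma> \<circ> disc_to_simplex n) ` disc_boundary n \<subseteq> (\<Union>(l, \<Psi>)\<in>F. \<Psi> ` disc_interior l)"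
proof -
  let ?c = "\<lambda>S. (card S - Suc 0, cell (subsimplex S \<sigma>) \<circ> disc_to_simplex (card S - Suc 0))"
  let ?S = "{S. S \<subset> {..n} \<and> S \<noteq> {}}"
  have less: "card S - Suc 0 < n" if "S \<in> ?S" for S
  proof -
    have S: "S \<subset> {..n}" "S \<noteq> {}" using that by blast+
    have "finite S" by (rule finite_subset[OF psubset_imp_subset[OF S(1)]]) simp
    then have "0 < card S" using S(2) by (simp add: card_gt_0_iff)
    moreover have "card S < card {..n}" by (rule psubset_card_mono[OF _ S(1)]) simp
    ultimately show ?thesis by simp
  qed
  have sub: "singular_simplex (card S - Suc 0) X (subsimplex S \<sigma>)" if "S \<in> ?S" for S
    using that by (intro subsimplex_singular_simplex[OF _ _ \<sigma>]) auto
  show ?thesis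
  proof (intro exI conjI)
    show "?c ` ?S \<subseteq> (skeleton_cells m X)"
    proof (rule image_subsetI)
      fix S assume S: "S \<in> ?S"
      have "card S - Suc 0 \<le> m" using less[OF S] n by linarith
      then show "?c S \<in> (skeleton_cells m X)" by (rule skeleton_cellsI[OF _ sub[OF S]])
    qed
    show "finite (?c ` ?S)"
      by (intro finite_imageI finite_subset[of ?S "Pow {..n}"]) auto
    show "\<forall>(l, \<Psi>)\<in>?c ` ?S. l < n" using less by auto
    show "(cell \<sigma> \<circ> disc_to_simplex n) ` disc_boundary n \<subseteq> (\<Union>(l, \<Psi>)\<in>?c ` ?S. \<Psi> ` disc_interior l)"
    proof (rule image_subsetI)
      fix z assume z: "z \<in> disc_boundary n"
      define x where "x = disc_to_simplex n z"
      let ?T = "{i. x i \<noteq> 0}"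
      have x: "x \<in> standard_simplex n" "x \<notin> open_simplex n"
        using z disc_to_simplex_in_simplex[of z n] disc_to_simplex_interior[of z n]
        by (auto simp: x_def disc_boundary_def disc_interior_def)
      then have T: "?T \<in> ?S"
        using supp_standard_simplex[OF x(1)] supp_nonempty[OF x(1)] by (auto simp: open_simplex_def)
      have "cell \<sigma> x \<in> {subsimplex ?T \<sigma>} \<times> open_simplex (card ?T - Suc 0)"
        using pick_support_in_open_simplex[OF x(1)] by (simp add: cell_def)
      then have "cell \<sigma> x \<in> (cell (subsimplex ?T \<sigma>) \<circ> disc_to_simplex (card ?T - Suc 0)) `
          disc_interior (card ?T - Suc 0)"
        unfolding image_open_cell[OF sub[OF T]] .
      with T show "(cell \<sigma> \<circ> disc_to_simplex n) z \<in> (\<Union>(l, \<Psi>)\<in>?c ` ?S. \<Psi> ` disc_interior l)"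
        unfolding x_def comp_def by (intro UN_I[of "?c ?T"]) (auto simp: x_def comp_def)
    qed
  qed
qed

lemma closedin_simplex_iff_closedin_disc:
  "closedin (simplex_space n) {x \<in> standard_simplex n. cell \<sigma> x \<in> A} \<longleftrightarrow>
    closedin (disc n) {x \<in> topspace (disc n). (cell \<sigma> \<circ> disc_to_simplex n) x \<in> A}"
proof -
  let ?Z = "{x \<in> topspace (disc n). (cell \<sigma> \<circ> disc_to_simplex n) x \<in> A}"
  have "disc_to_simplex n ` ?Z = {x \<in> standard_simplex n. cell \<sigma> x \<in> A}"
    using disc_to_simplex_in_simplex by (auto elim!: disc_to_simplex_surj)
  then show ?thesis
    using homeomorphic_map_closedness[OF homeomorphic_map_disc_to_simplex, of ?Z n] by auto
qed

lemma ball_skeleton_cells: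
  "(\<forall>(n, \<Phi>)\<in>skeleton_cells m X. Q n \<Phi>) \<longleftrightarrow>
    (\<forall>n\<le>m. \<forall>\<sigma>. singular_simplex n X \<sigma> \<longrightarrow> Q n (cell \<sigma> \<circ> disc_to_simplex n))"
  unfolding skeleton_cells_def by blast

lemma CW_structure_skeleton: "CW_structure (skeleton m X) (skeleton_cells m X)"
  unfolding CW_structure_def
proof (intro conjI allI impI)
  show "Hausdorff_space (skeleton m X)" by (rule Hausdorff_space_skeleton)
  show "\<forall>(n, \<Phi>)\<in>(skeleton_cells m X). continuous_map (disc n) (skeleton m X) \<Phi> \<and>
      embedding_map (subtopology (disc n) (disc_interior n)) (skeleton m X) \<Phi>"
    unfolding ball_skeleton_cells
    by (intro allI impI conjI continuous_map_characteristic embedding_map_characteristic)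
  show "\<forall>(n, \<Phi>)\<in>(skeleton_cells m X). \<exists>F\<subseteq>(skeleton_cells m X). finite F \<and> (\<forall>(l, \<Psi>)\<in>F. l < n) \<and>
      \<Phi> ` disc_boundary n \<subseteq> (\<Union>(l, \<Psi>)\<in>F. \<Psi> ` disc_interior l)"
    unfolding ball_skeleton_cells by (intro allI impI characteristic_boundary)
  fix A assume "A \<subseteq> topspace (skeleton m X)"
  then show "closedin (skeleton m X) A \<longleftrightarrow>
      (\<forall>(n, \<Phi>)\<in>skeleton_cells m X. closedin (disc n) {x \<in> topspace (disc n). \<Phi> x \<in> A})"
    unfolding topspace_skeleton ball_skeleton_cells
    by (simp only: closedin_skeleton closedin_simplex_iff_closedin_disc)
qed (rule disjoint_open_cells Union_open_cells)+

text \<open>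
  A constant singular simplex provides a cell of the top dimension.
\<close>

lemma CW_complex_of_dim_skeleton:
  assumes "topspace X \<noteq> {}" shows "CW_complex_of_dim m (skeleton m X)"
proof -
  obtain a where "a \<in> topspace X" using assms by blast
  then have "singular_simplex m X (restrict (\<lambda>x. a) (standard_simplex m))"
    by (simp add: singular_simplex_def continuous_map_eq[of _ _ "\<lambda>x. a"])
  then have "\<exists>\<Phi>. (m, \<Phi>) \<in> (skeleton_cells m X)" by (auto simp: skeleton_cells_def)
  moreover have "\<forall>(n, \<Phi>)\<in>(skeleton_cells m X). n \<le> m" by (auto simp: skeleton_cells_def)
  ultimately show ?thesis
    unfolding CW_complex_of_dim_def using CW_structure_skeleton by blast
qed

section \<open>Lifting singular simplices\<close>

lemma singular_face_eq_subsimplex: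
  assumes k: "k \<le> Suc n"
  shows "singular_face (Suc n) k \<sigma> = subsimplex ({..Suc n} - {k}) \<sigma>"
    and "y \<in> standard_simplex n \<Longrightarrow> simplical_face k y = spread ({..Suc n} - {k}) y"
proof -
  let ?S = "{..Suc n} - {k}"
  have card: "card ?S = Suc n" using k by simp
  have vertex: "vertex ?S j = (if j < k then j else Suc j)" if "j < Suc n" for j
  proof (rule vertex_unique[where n = "Suc n" and e = "\<lambda>j. if j < k then j else Suc j"])
    show "(\<lambda>j. if j < k then j else Suc j) ` {..<Suc n} = ?S"
    proof (intro equalityI subsetI)
      fix i assume "i \<in> ?S"
      then show "i \<in> (\<lambda>j. if j < k then j else Suc j) ` {..<Suc n}"
        using k by (intro image_eqI[of _ _ "if i < k then i else i - 1"]) auto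
    qed (use k in auto)
  qed (use that in auto)
  show spread: "simplical_face k y = spread ?S y" if y: "y \<in> standard_simplex n" for y
  proof (rule eq_spreadI)
    show "simplical_face k y i = 0" if "i \<notin> ?S" for i
    proof (cases "i = k")
      case False
      then have "i > Suc n" using that by simp
      then have "y (i - 1) = 0" using y by (simp add: standard_simplex_def)
      then show ?thesis using \<open>i > Suc n\<close> k by (simp add: simplical_face_def)
    qed (simp add: simplical_face_def)
    show "simplical_face k y (vertex ?S j) = y j" if "j < card ?S" for j
      using that card vertex[of j] by (simp add: simplical_face_def)
  qed simp
  show "singular_face (Suc n) k \<sigma> = subsimplex ?S \<sigma>"
    by (rule ext) (simp add: singular_face_def subsimplex_def card restrict_def spread)
qed

lemma cell_singular_face:
  assumes "k \<le> Suc n" "y \<in> standard_simplex n"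
  shows "cell (singular_face (Suc n) k \<sigma>) y = cell \<sigma> (simplical_face k y)"
  unfolding singular_face_eq_subsimplex[OF assms(1)] singular_face_eq_subsimplex(2)[OF assms]
proof (rule cell_subsimplex)
  have "card ({..Suc n} - {k}) = Suc n" using assms(1) by simp
  then show "y \<in> standard_simplex (card ({..Suc n} - {k}) - Suc 0)" "{..Suc n} - {k} \<noteq> {}"
    using assms(2) by auto
qed auto

lemma eval_cell:
  assumes "x \<in> standard_simplex n"
  shows "(case cell \<sigma> x of (\<tau>, y) \<Rightarrow> \<tau> y) = \<sigma> x"
proof -
  have fin: "finite {i. x i \<noteq> 0}" using supp_standard_simplex[OF assms] finite_subset by blast
  show ?thesis
    using pick_in_simplex[OF assms fin] by (simp add: cell_def subsimplex_def spread_pick[OF fin])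
qed

lemma continuous_map_eval: "continuous_map (skeleton m X) X (\<lambda>(\<tau>, y). \<tau> y)"
proof (rule continuous_map_from_skeleton)
  fix n \<sigma> assume "singular_simplex n X \<sigma>"
  then have "continuous_map (simplex_space n) X \<sigma>" by (simp add: singular_simplex_def)
  then show "continuous_map (simplex_space n) X ((\<lambda>(\<tau>, y). \<tau> y) \<circ> cell \<sigma>)"
    by (rule continuous_map_eq) (simp add: eval_cell)
qed

text \<open>
  Lift the evaluation map \<open>(\<tau>, y) \<mapsto> \<tau> y\<close> of the skeleton and compose with the characteristic maps.
  Compatibility of these with faces makes the lifts of simplices compatible with faces.
\<close>

lemma CW_liftable_imp_simplex_lifts:
  assumes lift: "CW_liftable m E B p U" and ne: "topspace (subtopology B U) \<noteq> {}"
  obtains L :: "nat \<Rightarrow> ((nat \<Rightarrow> real) \<Rightarrow> 'b) \<Rightarrow> (nat \<Rightarrow> real) \<Rightarrow> 'e"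
  where "\<And>n \<sigma>. n \<le> m \<Longrightarrow> singular_simplex n (subtopology B U) \<sigma> \<Longrightarrow> singular_simplex n E (L n \<sigma>)"
    and "\<And>n \<sigma>. n \<le> m \<Longrightarrow> singular_simplex n (subtopology B U) \<sigma> \<Longrightarrow> simplex_map n p (L n \<sigma>) = \<sigma>"
    and "\<And>n \<sigma> k. k \<le> Suc n \<Longrightarrow> singular_face (Suc n) k (L (Suc n) \<sigma>) = L n (singular_face (Suc n) k \<sigma>)"
proof -
  let ?P = "skeleton m (subtopology B U)"
  obtain s where s: "continuous_map ?P E s" "\<And>x. x \<in> topspace ?P \<Longrightarrow> p (s x) = (\<lambda>(\<tau>, y). \<tau> y) x"
    using lift[unfolded CW_liftable_def, rule_format, OF conjI, OF CW_complex_of_dim_skeleton[OF ne]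
        continuous_map_eval]
    by blast
  define L where "L = (\<lambda>n \<sigma>. restrict (s \<circ> cell \<sigma>) (standard_simplex n))"
  show thesis
  proof (rule that[of L])
    fix n and \<sigma> :: "(nat \<Rightarrow> real) \<Rightarrow> 'b"
    assume n: "n \<le> m" and \<sigma>: "singular_simplex n (subtopology B U) \<sigma>"
    have "continuous_map (simplex_space n) E (s \<circ> cell \<sigma>)"
      by (rule continuous_map_compose[OF continuous_map_cell[OF \<sigma> n] s(1)])
    then have "continuous_map (simplex_space n) E (L n \<sigma>)"
      by (rule continuous_map_eq) (simp add: L_def)
    then show "singular_simplex n E (L n \<sigma>)"
      by (simp add: singular_simplex_def L_def)
    have "p (s (cell \<sigma> x)) = \<sigma> x" if x: "x \<in> standard_simplex n" for x
      using s(2)[of "cell \<sigma> x"] cell_in_skeleton_points[OF \<sigma> n x] eval_cell[OF x] by simp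
    then show "simplex_map n p (L n \<sigma>) = \<sigma>"
      using \<sigma> by (auto simp: simplex_map_def L_def singular_simplex_def extensional_def fun_eq_iff)
  next
    fix n k and \<sigma> :: "(nat \<Rightarrow> real) \<Rightarrow> 'b"
    assume k: "k \<le> Suc n"
    show "singular_face (Suc n) k (L (Suc n) \<sigma>) = L n (singular_face (Suc n) k \<sigma>)"
    proof
      fix y
      show "singular_face (Suc n) k (L (Suc n) \<sigma>) y = L n (singular_face (Suc n) k \<sigma>) y"
        using simplical_face_in_standard_simplex[of "Suc n" k y] k cell_singular_face[OF k, of y \<sigma>]
        by (simp add: L_def singular_face_def restrict_def)
    qed
  qed
qed

text \<open>
  If \<open>b\<close> bounds the pullback of \<open>c\<close> to \<open>E\<close>, then \<open>\<tau> \<mapsto> b (L \<tau>)\<close> bounds \<open>c\<close> on \<open>U\<close>, where \<open>L\<close> lifts simplices.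
  Extended by zero to the other simplices of \<open>B\<close>, it yields the coboundary \<open>z\<close> on \<open>B\<close>. In degree \<open>0\<close>
  only zero is a coboundary, and a pullback that is zero forces \<open>c\<close> to vanish on the \<open>0\<close>-simplices of \<open>U\<close>.
\<close>

lemma coboundary_on_liftable:
  fixes c :: "('b, 'r::comm_ring) cochain"
  assumes lift: "CW_liftable m E B p U" and d: "d \<le> m"
    and c: "cochain_pullback d E p c \<in> coboundaries d E"
  obtains z where "z \<in> coboundaries d B"
    and "\<And>\<sigma>. singular_simplex d (subtopology B U) \<sigma> \<Longrightarrow> c \<sigma> = z \<sigma>"
proof (cases "topspace (subtopology B U) = {}")
  case True
  then show thesis
    using that[OF coboundaries_zero] singular_simplex_empty[OF True] by blast
next
  case False
  obtain L where L: "\<And>n \<sigma>. n \<le> m \<Longrightarrow> singular_simplex n (subtopology B U) \<sigma> \<Longrightarrow> singular_simplex n E (L n \<sigma>)"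
      "\<And>n \<sigma>. n \<le> m \<Longrightarrow> singular_simplex n (subtopology B U) \<sigma> \<Longrightarrow> simplex_map n p (L n \<sigma>) = \<sigma>"
      "\<And>n \<sigma> k. k \<le> Suc n \<Longrightarrow> singular_face (Suc n) k (L (Suc n) \<sigma>) = L n (singular_face (Suc n) k \<sigma>)"
    using CW_liftable_imp_simplex_lifts[OF lift False] by blast
  have pull: "c \<sigma> = cochain_pullback d E p c (L d \<sigma>)" if "singular_simplex d (subtopology B U) \<sigma>" for \<sigma>
    using L(1,2)[OF d that] by (simp add: cochain_pullback_def)
  show thesis
  proof (cases d)
    case 0
    then show thesis using c pull that[of "\<lambda>\<sigma>. 0"] by (simp add: coboundaries_def)
  next
    case (Suc l)
    obtain b where b: "cochain_pullback d E p c = coboundary l E b"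
      using c by (auto simp: Suc coboundaries_def)
    define b' where "b' = (\<lambda>\<tau>. if singular_simplex l (subtopology B U) \<tau> then b (L l \<tau>) else 0)"
    have "singular_cochain l B b'"
      by (auto simp: b'_def singular_cochain_def singular_simplex_subtopology)
    then have "coboundary l B b' \<in> coboundaries d B" by (auto simp: Suc coboundaries_def)
    moreover have "c \<sigma> = coboundary l B b' \<sigma>" if \<sigma>: "singular_simplex d (subtopology B U) \<sigma>" for \<sigma>
    proof -
      have "b' (singular_face (Suc l) k \<sigma>) = b (singular_face (Suc l) k (L (Suc l) \<sigma>))"
        if "k \<le> Suc l" for k
        using singular_simplex_singular_face[of "Suc l" _ \<sigma> k] \<sigma> that L(3)[OF that]
        by (simp add: b'_def Suc)
      moreover have "singular_simplex (Suc l) B \<sigma>" "singular_simplex (Suc l) E (L (Suc l) \<sigma>)"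
        using \<sigma> L(1)[OF d \<sigma>] by (auto simp: Suc singular_simplex_subtopology)
      ultimately show ?thesis
        unfolding pull[OF \<sigma>] b by (simp add: coboundary_def Suc cong: if_cong)
    qed
    ultimately show thesis by (rule that)
  qed
qed

section \<open>The lower bound for the sectional category\<close>

lemma cocycle_cohomologous_to_vanishing_on_liftable:
  assumes p: "cohomology_pullback n E p (cohomology_class n B c) = coboundaries n E"
    and c: "cocycle n B c" and n: "n \<le> m" and lift: "CW_liftable m E B p U"
  obtains c' where "cocycle n B c'" "cohomology_class n B c' = cohomology_class n B c"
    and "\<And>\<sigma>. singular_simplex n (subtopology B U) \<sigma> \<Longrightarrow> c' \<sigma> = 0"
proof -
  obtain z where z: "z \<in> coboundaries n B"
      "\<And>\<sigma>. singular_simplex n (subtopology B U) \<sigma> \<Longrightarrow> c \<sigma> = z \<sigma>"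
    using coboundary_on_liftable[OF lift n pullback_class_zero_imp_coboundary[OF p]] by blast
  let ?c' = "\<lambda>\<sigma>. c \<sigma> + - z \<sigma>"
  have "cocycle n B ?c'"
    by (intro cocycle_add cocycle_uminus c coboundaries_imp_cocycle[OF z(1)])
  moreover have "cohomology_class n B ?c' = cohomology_class n B c"
    by (rule cohomology_class_cong) (simp add: coboundaries_uminus[OF z(1)])
  moreover have "?c' \<sigma> = 0" if "singular_simplex n (subtopology B U) \<sigma>" for \<sigma>
    using z(2)[OF that] by simp
  ultimately show thesis by (rule that)
qed

text \<open>
  A simplex in \<open>V i\<close> has its front and back faces in \<open>V i\<close>, so the product of the representatives vanishes
  on it as soon as one factor does.
\<close>

lemma cup_upto_representative_vanishing:
  assumes c: "\<And>i. i \<le> j \<Longrightarrow> cocycle (d i) B (c i)" "\<And>i. i \<le> j \<Longrightarrow> u i = cohomology_class (d i) B (c i)"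
    and vanish: "\<And>i \<sigma>. i \<le> j \<Longrightarrow> singular_simplex (d i) (subtopology B (V i)) \<sigma> \<Longrightarrow> c i \<sigma> = 0"
  shows "\<exists>w. cocycle (\<Sum>i\<le>j. d i) B w \<and> cup_upto B d u j = cohomology_class (\<Sum>i\<le>j. d i) B w \<and>
    (\<forall>i\<le>j. \<forall>\<sigma>. singular_simplex (\<Sum>i\<le>j. d i) (subtopology B (V i)) \<sigma> \<longrightarrow> w \<sigma> = 0)"
  using assms
proof (induction j)
  case 0
  then show ?case by auto
next
  case (Suc j)
  let ?n = "\<Sum>i\<le>j. d i" and ?d = "d (Suc j)"
  obtain w where w: "cocycle ?n B w" "cup_upto B d u j = cohomology_class ?n B w"
    and w0: "\<And>i \<sigma>. i \<le> j \<Longrightarrow> singular_simplex ?n (subtopology B (V i)) \<sigma> \<Longrightarrow> w \<sigma> = 0"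
    using Suc.IH Suc.prems by (metis le_SucI)
  let ?w = "cochain_cup B ?n ?d w (c (Suc j))"
  have "?w \<sigma> = 0" if i: "i \<le> Suc j" and \<sigma>: "singular_simplex (?n + ?d) (subtopology B (V i)) \<sigma>" for i \<sigma>
  proof (cases "i = Suc j")
    case True
    then have "c (Suc j) (back_face ?n ?d \<sigma>) = 0"
      using Suc.prems(3) singular_simplex_back_face[OF \<sigma>] by blast
    then show ?thesis by (simp add: cochain_cup_def)
  next
    case False
    then have "w (front_face ?n \<sigma>) = 0"
      using w0[of i] i singular_simplex_front_face[OF \<sigma>] by simp
    then show ?thesis by (simp add: cochain_cup_def)
  qed
  moreover have "cup_upto B d u (Suc j) = cohomology_class (?n + ?d) B ?w"
    using Suc.prems(1,2) by (simp add: w(2) cup_classes[OF w(1)])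
  moreover have "cocycle (?n + ?d) B ?w" using Suc.prems(1) by (intro cocycle_cup w(1)) auto
  ultimately show ?case by (intro exI[of _ ?w]) simp
qed

theorem proposition2p7:
  fixes E :: "'e topology" and B :: "'b topology" and p :: "'e \<Rightarrow> 'b"
    and k :: nat and d :: "nat \<Rightarrow> nat"
    and u :: "nat \<Rightarrow> ('b, 'r::comm_ring) cochain set"
  assumes "fibration E B p"
    and "\<And>i. i \<le> k \<Longrightarrow> u i \<in> carrier (cohomology_group (d i) B)"
    and "\<And>i. i \<le> k \<Longrightarrow> cohomology_pullback (d i) E p (u i) = \<one>\<^bsub>cohomology_group (d i) E\<^esub>"
    and "cup_upto B d u k \<noteq> \<one>\<^bsub>cohomology_group (\<Sum>i\<le>k. d i) B\<^esub>"
  shows "secat (Max (d ` {..k})) E B p \<ge> enat (k + 1)"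
  unfolding secat_def
proof (rule Inf_greatest)
  let ?m = "Max (d ` {..k})"
  fix x assume "x \<in> {enat l | l. \<exists>U :: nat \<Rightarrow> 'b set. (\<forall>i\<le>l. openin B (U i)) \<and>
      (\<Union>i\<le>l. U i) = topspace B \<and> (\<forall>i\<le>l. CW_liftable ?m E B p (U i))}"
  then obtain l U where x: "x = enat l" and U: "\<And>i. i \<le> l \<Longrightarrow> openin B (U i)"
      "(\<Union>i\<le>l. U i) = topspace B" "\<And>i. i \<le> l \<Longrightarrow> CW_liftable ?m E B p (U i)"
    by auto
  have "l > k"
  proof (rule ccontr)
    assume "\<not> l > k"
    \<comment> \<open>A cover with fewer than \<open>k + 1\<close> members is padded by repeating its last member.\<close>
    define V where "V = (\<lambda>i. U (min i l))"
    have "\<exists>c. cocycle (d i) B c \<and> u i = cohomology_class (d i) B c \<and>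
        (\<forall>\<sigma>. singular_simplex (d i) (subtopology B (V i)) \<sigma> \<longrightarrow> c \<sigma> = 0)" if i: "i \<le> k" for i
    proof -
      obtain c where c: "cocycle (d i) B c" "u i = cohomology_class (d i) B c"
        using carrier_cohomology_group[OF assms(2)[OF i]] .
      have "d i \<le> ?m" using i by (intro Max_ge) auto
      moreover have "CW_liftable ?m E B p (V i)" using U(3) by (simp add: V_def)
      ultimately show ?thesis
        using cocycle_cohomologous_to_vanishing_on_liftable[OF _ c(1)] assms(3)[OF i] c(2)
        unfolding one_cohomology_group by metis
    qed
    then obtain c where "\<And>i. i \<le> k \<Longrightarrow> cocycle (d i) B (c i)"
        "\<And>i. i \<le> k \<Longrightarrow> u i = cohomology_class (d i) B (c i)"
        "\<And>i \<sigma>. i \<le> k \<Longrightarrow> singular_simplex (d i) (subtopology B (V i)) \<sigma> \<Longrightarrow> c i \<sigma> = 0"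
      by metis
    from cup_upto_representative_vanishing[where j = k and d = d and c = c and u = u and V = V, OF this]
    obtain w where w: "cocycle (\<Sum>i\<le>k. d i) B w" "cup_upto B d u k = cohomology_class (\<Sum>i\<le>k. d i) B w"
      and w0: "\<And>i \<sigma>. i \<le> k \<Longrightarrow> singular_simplex (\<Sum>i\<le>k. d i) (subtopology B (V i)) \<sigma> \<Longrightarrow> w \<sigma> = 0"
      by auto
    have "w \<in> coboundaries (\<Sum>i\<le>k. d i) B"
    proof (rule cocycle_vanishing_on_small_simplices[of "V ` {..k}"])
      show "openin B W" if "W \<in> V ` {..k}" for W using that U(1) by (auto simp: V_def)
      have "U i \<subseteq> \<Union>(V ` {..k})" if "i \<le> l" for i
        using that \<open>\<not> l > k\<close> by (intro Union_upper image_eqI[of _ _ i]) (auto simp: V_def)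
      then show "topspace B \<subseteq> \<Union>(V ` {..k})"
        unfolding U(2)[symmetric] by (intro UN_least) simp
    qed (use w(1) w0 in \<open>auto simp: cocycle_def\<close>)
    then show False
      using assms(4) w(2) by (simp add: one_cohomology_group cohomology_class_coboundary)
  qed
  then show "enat (k + 1) \<le> x" by (simp add: x)
qed

end
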